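(* Let $G = F,\ (s_1\otimes s_2)\bowtie (t\lor * )$ be an AC typed forest (with cut). Let $E = u_1,\dots,u_n,s_2$ be a subnet of $G$ (with roots $u_1,\dots,u_n,s_2$), such that each $u_i$ is either a root of $G$, or a successor of an expansion containing at least one term (summand) not in $E$, or a successor of a disjunction node the other successor of which is neither an instance of $*$ nor in $E$. Let $F'$ be the forest derived from $F$ as follows: for each $i$, if $u_i$ is a root of $G$ or a summand of an expansion, delete it; otherwise (if it is a successor of a disjunction) replace it by $*$. Then $$G' = F',\ s_1\bowtie t$$ is an AC typed forest (with cut), and the type of $G'$ is a subsequent of the type of $G$ (i.e. is obtained from it by deleting some of its members).
   Context: **Formulae.** $A ::= a \mid \bar a \mid \top \mid \bot \mid A\land A \mid A\lor A$ ($a$ a proposition symbol); $\bar A$ is the De Morgan dual of $A$. **Expansion trees.** Wire variables come in dual pairs $x,\bar x$. Expansion trees $t$ and witnesses $w$: $t ::= 1 \mid (w+\dots+w) \mid (t\lor t)\mid (t\lor * )\mid ( *\lor t)$, $w ::= x\mid \bar x\mid t\otimes t$, where $(w_1+\dots+w_n)$ is a nonempty finite formal (unordered) sum, called an expansion; $(s_1\otimes s_2)$ denotes the expansion with single summand $s_1\otimes s_2$. Note that $*$ may occur only inside default weakenings $(t\lor * )$ and $( *\lor t)$. **Types.** A type is a formula or a witness type $[a]$, $[\bar a]$, $A\otimes B$. Typing: $x:[p]$, $\bar x:[\bar p]$; $1:\top$; $(t\lor * ):A\lor B$ if $t:A$; $( *\lor t):A\lor B$ if $t:B$; $(t\lor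 s):A\lor B$ and $t\otimes s:A\otimes B$ if $t:A,s:B$; $(w_1+\dots+w_n)$ has type $p$, $\bar p$, $A\land B$ if all $w_i$ have type $[p]$, $[\bar p]$, $A\otimes B$ respectively. **Cuts.** A cut tree $t\bowtie s$ is an unordered pair of expansion trees $t:A$, $s:\bar A$ with $A\neq\top,\bot$. A typed forest with cut is a finite collection of typed expansion trees, typed witnesses and cut trees in which each wire variable occurs at most once and $x$ occurs iff $\bar x$ occurs; its type is the collection of types of its roots that are not cuts. **AC-correctness.** View a typed forest with cut as a forest of nodes (subterm occurrences, including occurrences of $*$), where a cut $t\bowtie s$ is a root node with successors $t,s$; $(t\lor * )$ has successors $t$ and $*$; an expansion has its summands as successors; wire variables, $1$ and $*$ are leaves. Its graph has an edge from each node to its predecessor and an edge between $x$ and $\bar x$ for each wire variable. Switched nodes are expansions and nodes $t\lor s$ with neither $t$ nor $s$ equal to $*$; all other nodes are unswitched. A switching chooses one successor of each switched node; its switching graph is obtained from the graph by deleting all edges from the non-chosen successors of switched nodes to those nodes and forgetting directions. The forest is AC (AC-correct) if every switching graph is acyclic. A switching path is a path in some switching graph. **Subnets.** A substructure is a nonempty set of nodes closed under taking successors, closed under axiom links (if it contains a wire variable occurrence it contains its dual), and such that if it contains an occurrence of $*$ it contains the predecessor of that occurrence; its roots are its nodes with no predecessor in it. A subnet of an AC forest is a substructure $H$ such that for any two roots of $H$ every switching path between them lies inside $H$. *)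

theory Defs
  imports "HOL-Library.Multiset"
begin

datatype 'p formula =
    PosAtom 'p
  | NegAtom 'p
  | Top
  | Bot
  | And "'p formula" "'p formula"
  | Or "'p formula" "'p formula"

primrec dual :: "'p formula \<Rightarrow> 'p formula" where
  "dual (PosAtom a) = NegAtom a"
| "dual (NegAtom a) = PosAtom a"
| "dual Top = Bot"
| "dual Bot = Top"
| "dual (And A B) = Or (dual A) (dual B)"
| "dual (Or A B) = And (dual A) (dual B)"

datatype 'p wit_type =
    PosWit 'p
  | NegWit 'p
  | TensorWit "'p formula" "'p formula"

datatype 'p type =
    FormulaType "'p formula"
  | WitType "'p wit_type"

text \<open>
  Formal sums, cuts and forests are unordered.  They are represented here by a list of summands,
  an ordered pair and a list of roots, so that node occurrences can be named by positions even when
  the same term occurs several times.  Every notion below is insensitive to the chosen order.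
  Sums are nonempty in every typed term.  A wire variable \<open>v\<close> stands for a dual pair:
  \<open>Var v\<close> is the variable itself and \<open>CoVar v\<close> its dual.
  \<open>WeakR t\<close> is the default weakening with \<open>*\<close> on the right, \<open>WeakL t\<close> the one with \<open>*\<close> on the left.
\<close>

datatype 'v tree =
    One
  | Expansion "'v witness list"
  | Disj "'v tree" "'v tree"
  | WeakR "'v tree"
  | WeakL "'v tree"
and 'v witness =
    Var 'v
  | CoVar 'v
  | Tensor "'v tree" "'v tree"

text \<open>
  \<open>\<Gamma>\<close> assigns a proposition symbol to each dual pair of wire variables, so that the two ends of
  an axiom link have dual types.
\<close>

inductive tree_typing :: "('v \<Rightarrow> 'p) \<Rightarrow> 'v tree \<Rightarrow> 'p formula \<Rightarrow> bool"
  and wit_typing :: "('v \<Rightarrow> 'p) \<Rightarrow> 'v witness \<Rightarrow> 'p wit_type \<Rightarrow> bool"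
  for \<Gamma> :: "'v \<Rightarrow> 'p" where
  "wit_typing \<Gamma> (Var v) (PosWit (\<Gamma> v))"
| "wit_typing \<Gamma> (CoVar v) (NegWit (\<Gamma> v))"
| "tree_typing \<Gamma> t A \<Longrightarrow> tree_typing \<Gamma> s B \<Longrightarrow> wit_typing \<Gamma> (Tensor t s) (TensorWit A B)"
| "tree_typing \<Gamma> One Top"
| "tree_typing \<Gamma> t A \<Longrightarrow> tree_typing \<Gamma> (WeakR t) (Or A B)"
| "tree_typing \<Gamma> t B \<Longrightarrow> tree_typing \<Gamma> (WeakL t) (Or A B)"
| "tree_typing \<Gamma> t A \<Longrightarrow> tree_typing \<Gamma> s B \<Longrightarrow> tree_typing \<Gamma> (Disj t s) (Or A B)"
| "ws \<noteq> [] \<Longrightarrow> (\<And>w. w \<in> set ws \<Longrightarrow> wit_typing \<Gamma> w (PosWit a)) \<Longrightarrow>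
    tree_typing \<Gamma> (Expansion ws) (PosAtom a)"
| "ws \<noteq> [] \<Longrightarrow> (\<And>w. w \<in> set ws \<Longrightarrow> wit_typing \<Gamma> w (NegWit a)) \<Longrightarrow>
    tree_typing \<Gamma> (Expansion ws) (NegAtom a)"
| "ws \<noteq> [] \<Longrightarrow> (\<And>w. w \<in> set ws \<Longrightarrow> wit_typing \<Gamma> w (TensorWit A B)) \<Longrightarrow>
    tree_typing \<Gamma> (Expansion ws) (And A B)"

text \<open>
  Terms do not determine their types (because of default weakenings), so the members of a forest
  carry them.  In \<open>Cut t s A\<close> the trees \<open>t\<close> and \<open>s\<close> have types \<open>A\<close> and \<open>dual A\<close>.
\<close>

datatype ('v, 'p) root =
    TreeRoot "'v tree" "'p formula"
  | WitRoot "'v witness" "'p wit_type"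
  | Cut "'v tree" "'v tree" "'p formula"

type_synonym ('v, 'p) forest = "('v, 'p) root list"

primrec root_typing :: "('v \<Rightarrow> 'p) \<Rightarrow> ('v, 'p) root \<Rightarrow> bool" where
  "root_typing \<Gamma> (TreeRoot t A) \<longleftrightarrow> tree_typing \<Gamma> t A"
| "root_typing \<Gamma> (WitRoot w W) \<longleftrightarrow> wit_typing \<Gamma> w W"
| "root_typing \<Gamma> (Cut t s A) \<longleftrightarrow>
    tree_typing \<Gamma> t A \<and> tree_typing \<Gamma> s (dual A) \<and> A \<noteq> Top \<and> A \<noteq> Bot"

primrec root_type :: "('v, 'p) root \<Rightarrow> 'p type option" where
  "root_type (TreeRoot t A) = Some (FormulaType A)"
| "root_type (WitRoot w W) = Some (WitType W)"
| "root_type (Cut t s A) = None"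

definition forest_type :: "('v, 'p) forest \<Rightarrow> 'p type multiset" where
  "forest_type G = mset (List.map_filter root_type G)"

text \<open>
  The nodes of a forest are positions: \<open>i # p\<close> is the node reached from the \<open>i\<close>-th root by
  following the successor indices in \<open>p\<close>.  The empty list is not a node.
\<close>

datatype 'v label =
    TreeLabel "'v tree"
  | WitLabel "'v witness"
  | StarLabel
  | CutLabel "'v tree" "'v tree"

fun children :: "'v label \<Rightarrow> 'v label list" where
  "children (TreeLabel One) = []"
| "children (TreeLabel (Expansion ws)) = map WitLabel ws"
| "children (TreeLabel (Disj t s)) = [TreeLabel t, TreeLabel s]"
| "children (TreeLabel (WeakR t)) = [TreeLabel t, StarLabel]"
| "children (TreeLabel (WeakL t)) = [StarLabel, TreeLabel t]"
| "children (WitLabel (Var v)) = []"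
| "children (WitLabel (CoVar v)) = []"
| "children (WitLabel (Tensor t s)) = [TreeLabel t, TreeLabel s]"
| "children StarLabel = []"
| "children (CutLabel t s) = [TreeLabel t, TreeLabel s]"

primrec root_label :: "('v, 'p) root \<Rightarrow> 'v label" where
  "root_label (TreeRoot t A) = TreeLabel t"
| "root_label (WitRoot w W) = WitLabel w"
| "root_label (Cut t s A) = CutLabel t s"

type_synonym node = "nat list"

fun descend :: "'v label list \<Rightarrow> node \<Rightarrow> 'v label option" where
  "descend ls [] = None"
| "descend ls [i] = (if i < length ls then Some (ls ! i) else None)"
| "descend ls (i # j # p) = (if i < length ls then descend (children (ls ! i)) (j # p) else None)"

definition node_at :: "('v, 'p) forest \<Rightarrow> node \<Rightarrow> 'v label option" where
  "node_at G p = descend (map root_label G) p"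

definition nodes :: "('v, 'p) forest \<Rightarrow> node set" where
  "nodes G = {p. node_at G p \<noteq> None}"

definition successor :: "('v, 'p) forest \<Rightarrow> node \<Rightarrow> node \<Rightarrow> bool" where
  "successor G p q \<longleftrightarrow> p \<in> nodes G \<and> q \<in> nodes G \<and> (\<exists>i. q = p @ [i])"

definition axiom_link :: "('v, 'p) forest \<Rightarrow> node \<Rightarrow> node \<Rightarrow> bool" where
  "axiom_link G p q \<longleftrightarrow>
    (\<exists>v. node_at G p = Some (WitLabel (Var v)) \<and> node_at G q = Some (WitLabel (CoVar v)) \<or>
         node_at G p = Some (WitLabel (CoVar v)) \<and> node_at G q = Some (WitLabel (Var v)))"

definition typed_forest :: "('v \<Rightarrow> 'p) \<Rightarrow> ('v, 'p) forest \<Rightarrow> bool" where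
  "typed_forest \<Gamma> G \<longleftrightarrow>
    (\<forall>r \<in> set G. root_typing \<Gamma> r) \<and>
    (\<forall>v p q. node_at G p = Some (WitLabel (Var v)) \<and> node_at G q = Some (WitLabel (Var v))
      \<longrightarrow> p = q) \<and>
    (\<forall>v p q. node_at G p = Some (WitLabel (CoVar v)) \<and> node_at G q = Some (WitLabel (CoVar v))
      \<longrightarrow> p = q) \<and>
    (\<forall>v. (\<exists>p. node_at G p = Some (WitLabel (Var v))) \<longleftrightarrow>
         (\<exists>p. node_at G p = Some (WitLabel (CoVar v))))"

definition is_expansion :: "('v, 'p) forest \<Rightarrow> node \<Rightarrow> bool" where
  "is_expansion G p \<longleftrightarrow> (\<exists>ws. node_at G p = Some (TreeLabel (Expansion ws)))"

definition is_disjunction :: "('v, 'p) forest \<Rightarrow> node \<Rightarrow> bool" where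
  "is_disjunction G p \<longleftrightarrow>
    (\<exists>t s. node_at G p = Some (TreeLabel (Disj t s))) \<or>
    (\<exists>t. node_at G p = Some (TreeLabel (WeakR t))) \<or>
    (\<exists>t. node_at G p = Some (TreeLabel (WeakL t)))"

definition switched :: "('v, 'p) forest \<Rightarrow> node \<Rightarrow> bool" where
  "switched G p \<longleftrightarrow> is_expansion G p \<or> (\<exists>t s. node_at G p = Some (TreeLabel (Disj t s)))"

definition switching :: "('v, 'p) forest \<Rightarrow> (node \<Rightarrow> node) \<Rightarrow> bool" where
  "switching G \<sigma> \<longleftrightarrow> (\<forall>p. switched G p \<longrightarrow> successor G p (\<sigma> p))"

definition switching_graph :: "('v, 'p) forest \<Rightarrow> (node \<Rightarrow> node) \<Rightarrow> node set set" where
  "switching_graph G \<sigma> =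
    {{q, p} | p q. successor G p q \<and> (switched G p \<longrightarrow> \<sigma> p = q)} \<union>
    {{p, q} | p q. axiom_link G p q}"

definition path :: "'a set set \<Rightarrow> 'a list \<Rightarrow> bool" where
  "path E ps \<longleftrightarrow> distinct ps \<and> successively (\<lambda>p q. {p, q} \<in> E) ps"

definition acyclic_graph :: "'a set set \<Rightarrow> bool" where
  "acyclic_graph E \<longleftrightarrow> \<not> (\<exists>ps. length ps \<ge> 3 \<and> path E ps \<and> {last ps, hd ps} \<in> E)"

definition AC :: "('v, 'p) forest \<Rightarrow> bool" where
  "AC G \<longleftrightarrow> (\<forall>\<sigma>. switching G \<sigma> \<longrightarrow> acyclic_graph (switching_graph G \<sigma>))"

definition switching_path :: "('v, 'p) forest \<Rightarrow> node list \<Rightarrow> bool" where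
  "switching_path G ps \<longleftrightarrow> (\<exists>\<sigma>. switching G \<sigma> \<and> set ps \<subseteq> nodes G \<and> path (switching_graph G \<sigma>) ps)"

definition substructure :: "('v, 'p) forest \<Rightarrow> node set \<Rightarrow> bool" where
  "substructure G H \<longleftrightarrow>
    H \<noteq> {} \<and> H \<subseteq> nodes G \<and>
    (\<forall>p q. p \<in> H \<and> successor G p q \<longrightarrow> q \<in> H) \<and>
    (\<forall>p q. p \<in> H \<and> axiom_link G p q \<longrightarrow> q \<in> H) \<and>
    (\<forall>p q. q \<in> H \<and> node_at G q = Some StarLabel \<and> successor G p q \<longrightarrow> p \<in> H)"

definition roots :: "('v, 'p) forest \<Rightarrow> node set \<Rightarrow> node set" where
  "roots G H = {q \<in> H. \<not> (\<exists>p \<in> H. successor G p q)}"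

definition subnet :: "('v, 'p) forest \<Rightarrow> node set \<Rightarrow> bool" where
  "subnet G H \<longleftrightarrow>
    AC G \<and> substructure G H \<and>
    (\<forall>ps. switching_path G ps \<and> ps \<noteq> [] \<and> hd ps \<in> roots G H \<and> last ps \<in> roots G H
      \<longrightarrow> set ps \<subseteq> H)"

text \<open>
  \<open>prune U 0 F\<close> treats all nodes of \<open>U\<close> simultaneously: roots and summands in \<open>U\<close> are deleted, and
  a disjunct in \<open>U\<close> is replaced by \<open>*\<close>.  The argument \<open>p\<close> is the position of the term being pruned.
  Disjunctions with both disjuncts in \<open>U\<close> are given an arbitrary result, and members of \<open>U\<close> that
  are not a root, a summand or a disjunct of a \<open>Disj\<close> node are ignored.
\<close>

fun prune_tree :: "node set \<Rightarrow> node \<Rightarrow> 'v tree \<Rightarrow> 'v tree"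
  and prune_wit :: "node set \<Rightarrow> node \<Rightarrow> 'v witness \<Rightarrow> 'v witness"
  and prune_sum :: "node set \<Rightarrow> node \<Rightarrow> nat \<Rightarrow> 'v witness list \<Rightarrow> 'v witness list" where
  "prune_tree U p One = One"
| "prune_tree U p (Expansion ws) = Expansion (prune_sum U p 0 ws)"
| "prune_tree U p (Disj t s) =
    (if p @ [1] \<in> U then WeakR (prune_tree U (p @ [0]) t)
     else if p @ [0] \<in> U then WeakL (prune_tree U (p @ [1]) s)
     else Disj (prune_tree U (p @ [0]) t) (prune_tree U (p @ [1]) s))"
| "prune_tree U p (WeakR t) = WeakR (prune_tree U (p @ [0]) t)"
| "prune_tree U p (WeakL t) = WeakL (prune_tree U (p @ [1]) t)"
| "prune_wit U p (Var v) = Var v"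
| "prune_wit U p (CoVar v) = CoVar v"
| "prune_wit U p (Tensor t s) = Tensor (prune_tree U (p @ [0]) t) (prune_tree U (p @ [1]) s)"
| "prune_sum U p i [] = []"
| "prune_sum U p i (w # ws) =
    (if p @ [i] \<in> U then [] else [prune_wit U (p @ [i]) w]) @ prune_sum U p (Suc i) ws"

primrec prune_root :: "node set \<Rightarrow> node \<Rightarrow> ('v, 'p) root \<Rightarrow> ('v, 'p) root" where
  "prune_root U p (TreeRoot t A) = TreeRoot (prune_tree U p t) A"
| "prune_root U p (WitRoot w W) = WitRoot (prune_wit U p w) W"
| "prune_root U p (Cut t s A) = Cut (prune_tree U (p @ [0]) t) (prune_tree U (p @ [1]) s) A"

primrec prune :: "node set \<Rightarrow> nat \<Rightarrow> ('v, 'p) forest \<Rightarrow> ('v, 'p) forest" where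
  "prune U i [] = []"
| "prune U i (r # rs) = (if [i] \<in> U then [] else [prune_root U [i] r]) @ prune U (Suc i) rs"

definition removable :: "('v, 'p) forest \<Rightarrow> node set \<Rightarrow> node \<Rightarrow> bool" where
  "removable G E u \<longleftrightarrow>
    (u \<in> nodes G \<and> \<not> (\<exists>p. successor G p u)) \<or>
    (\<exists>p. is_expansion G p \<and> successor G p u \<and> (\<exists>q. successor G p q \<and> q \<notin> E)) \<or>
    (\<exists>p q. is_disjunction G p \<and> successor G p u \<and> successor G p q \<and> q \<noteq> u \<and>
       node_at G q \<noteq> Some StarLabel \<and> q \<notin> E)"

text \<open>The position of \<open>s2\<close> used in the theorem.\<close>

lemma "node_at (F @ [Cut (Expansion [Tensor s1 s2]) (WeakR t) C]) [length F, 0, 0, 1]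
    = Some (TreeLabel s2)"
  by (simp add: node_at_def nth_append)

end

theory Submission
  imports Defs "HOL-Library.Sublist"
begin

text \<open>
  The reduct arises in two independent steps.  First the cut on the conjunction is replaced by the
  cut between \<open>s1\<close> and \<open>t\<close>, forgetting \<open>s2\<close>, and then the nodes \<open>U\<close> are pruned from the result.

  Both steps preserve AC-correctness, because every switching graph of the new forest is essentially
  contained in a switching graph of the old one.  In the first step, \<open>s1\<close> and \<open>t\<close> are linked through
  the new cut, where they were linked by the path \<open>s1\<close>, tensor, expansion, cut, weakening, \<open>t\<close>; the
  path exists in every switching graph, and contracting it creates no cycle.  In the second step
  nodes disappear, and a disjunction that loses a disjunct becomes unswitched; the old switching is
  chosen to select the other disjunct, and the new \<open>*\<close> is a leaf, which lies on no cycle.  The lemmas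
  \<open>AC_reduct\<close> and \<open>AC_prune\<close> express this by a map from the new positions to the old ones, and
  \<open>acyclic_graph_pullback\<close> transports acyclicity along the map.

  The subnet condition ensures that no \<open>u\<close> in \<open>U\<close> lies in the cut: otherwise the tree path from
  \<open>s2\<close> to \<open>u\<close>, which turns around at the tensor or at the cut, would be a switching path between
  two roots of \<open>E\<close> that leaves \<open>E\<close> (\<open>subnet_roots_in_context\<close>).  So pruning affects only \<open>F\<close>.

  Types survive because a removable node leaves a summand or a disjunct behind.  Every node of \<open>E\<close> is
  below \<open>s2\<close> or a member of \<open>U\<close>, so the wire variables that disappear are those in \<open>E\<close>; as \<open>E\<close> is
  closed under axiom links, they disappear in dual pairs.
\<close>

section \<open>Acyclic graphs\<close>

abbreviation connected_in :: "'a set set \<Rightarrow> 'a \<Rightarrow> 'a \<Rightarrow> bool" where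
  "connected_in E \<equiv> (\<lambda>x y. {x, y} \<in> E)\<^sup>*\<^sup>*"

lemma connected_in_sym: "connected_in E x y \<Longrightarrow> connected_in E y x"
proof (induction rule: rtranclp_induct)
  case (step y z)
  then have "{z, y} \<in> E" by (simp add: insert_commute)
  with step.IH show ?case by (meson converse_rtranclp_into_rtranclp)
qed auto

lemma rtranclp_simple_path:
  assumes "r\<^sup>*\<^sup>* x y"
  shows "\<exists>ps. ps \<noteq> [] \<and> distinct ps \<and> successively r ps \<and> hd ps = x \<and> last ps = y"
  using assms
proof (induction rule: rtranclp_induct)
  case base
  show ?case by (rule exI[of _ "[x]"]) simp
next
  case (step y z)
  then obtain ps where ps: "ps \<noteq> []" "distinct ps" "successively r ps" "hd ps = x" "last ps = y"
    by blast
  show ?case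
  proof (cases "z \<in> set ps")
    case True
    then obtain xs ys where "ps = xs @ z # ys" by (meson split_list)
    with ps show ?thesis
      by (intro exI[of _ "xs @ [z]"]) (auto simp: successively_append_iff hd_append)
  next
    case False
    with ps step show ?thesis
      by (intro exI[of _ "ps @ [z]"]) (auto simp: successively_append_iff)
  qed
qed

lemma successively_imp_rtranclp:
  "successively r ps \<Longrightarrow> ps \<noteq> [] \<Longrightarrow> r\<^sup>*\<^sup>* (hd ps) (last ps)"
proof (induction ps rule: induct_list012)
  case (3 x y zs)
  then show ?case by (auto intro: converse_rtranclp_into_rtranclp)
qed auto

text \<open>
  In an acyclic graph every edge is a bridge.  Connectivity without a given edge is easier to
  transport between graphs than a cycle, which is a list of distinct vertices.
\<close>

lemma acyclic_graph_bridge: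
  assumes "acyclic_graph E" "{a, b} \<in> E" "a \<noteq> b"
  shows "\<not> connected_in (E - {{a, b}}) a b"
proof
  assume "connected_in (E - {{a, b}}) a b"
  from rtranclp_simple_path[OF this] obtain ps where ps: "ps \<noteq> []" "distinct ps"
      "successively (\<lambda>x y. {x, y} \<in> E - {{a, b}}) ps" "hd ps = a" "last ps = b"
    by blast
  have "length ps \<ge> 3"
  proof (rule ccontr)
    assume "\<not> length ps \<ge> 3"
    then consider "length ps = 0" | "length ps = 1" | "length ps = 2" by linarith
    then show False
      using ps \<open>a \<noteq> b\<close> by cases (auto simp: length_Suc_conv numeral_2_eq_2)
  qed
  moreover have "path E ps"
    using ps by (auto simp: path_def elim!: successively_mono)
  ultimately show False
    using assms ps unfolding acyclic_graph_def by (metis insert_commute)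
qed

lemma cycle_closing_edge:
  assumes ps: "length ps \<ge> 3" "path E ps"
  shows "hd ps \<noteq> last ps" "connected_in (E - {{hd ps, last ps}}) (hd ps) (last ps)"
proof -
  define n where "n = length ps"
  have hl: "hd ps = ps ! 0" "last ps = ps ! (n - 1)" "n \<ge> 3"
    using ps by (auto simp: n_def hd_conv_nth last_conv_nth simp flip: length_greater_0_conv)
  have d: "ps ! i = ps ! j \<longleftrightarrow> i = j" if "i < n" "j < n" for i j
    using that ps by (simp add: path_def nth_eq_iff_index_eq n_def)
  show "hd ps \<noteq> last ps" using d[of 0 "n - 1"] hl by simp
  have "{ps ! i, ps ! Suc i} \<noteq> {hd ps, last ps}" if "Suc i < n" for i
  proof -
    have "ps ! Suc i \<noteq> hd ps" "ps ! i \<noteq> last ps" "ps ! i \<noteq> hd ps \<or> ps ! Suc i \<noteq> last ps"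
      using that hl(3) unfolding hl(1,2) by (simp_all add: d) arith
    then show ?thesis by (metis doubleton_eq_iff)
  qed
  then have "successively (\<lambda>x y. {x, y} \<in> E - {{hd ps, last ps}}) ps"
    using ps by (auto simp: path_def successively_conv_nth n_def)
  moreover have "ps \<noteq> []" using ps by auto
  ultimately show "connected_in (E - {{hd ps, last ps}}) (hd ps) (last ps)"
    by (rule successively_imp_rtranclp)
qed

text \<open>
  A cycle of \<open>E'\<close> through \<open>{x, y}\<close> joins \<open>x\<close> to \<open>y\<close> without that edge.  If \<open>g\<close> carries
  every other edge to a connection that avoids some edge \<open>{c, d}\<close> of \<open>E\<close>, and \<open>c\<close>, \<open>d\<close> are tied to
  the images of \<open>x\<close> and \<open>y\<close>, then \<open>{c, d}\<close> is not a bridge.  Edges may be stretched to paths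
  (the cut) or contracted to a point (the edges to new occurrences of \<open>*\<close>); since the
  latter have no image in \<open>E\<close>, the edges at a vertex of degree one are exempt.
\<close>

lemma acyclic_graph_pullback:
  assumes ac: "acyclic_graph E"
    and edge: "\<And>x y. {x, y} \<in> E' \<Longrightarrow> x \<noteq> y \<Longrightarrow>
      (\<forall>z. {x, z} \<in> E' \<longrightarrow> z = y) \<or> (\<forall>z. {y, z} \<in> E' \<longrightarrow> z = x) \<or>
      (\<exists>c d. {c, d} \<in> E \<and> c \<noteq> d \<and>
        connected_in (E - {{c, d}}) c (g x) \<and> connected_in (E - {{c, d}}) (g y) d \<and>
        (\<forall>x' y'. {x', y'} \<in> E' \<and> {x', y'} \<noteq> {x, y} \<longrightarrow>
          connected_in (E - {{c, d}}) (g x') (g y')))"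
  shows "acyclic_graph E'"
  unfolding acyclic_graph_def
proof
  assume "\<exists>ps. 3 \<le> length ps \<and> path E' ps \<and> {last ps, hd ps} \<in> E'"
  then obtain ps where ps: "length ps \<ge> 3" "path E' ps" "{last ps, hd ps} \<in> E'" by blast
  define x y where "x = hd ps" and "y = last ps"
  have xy: "x \<noteq> y" "{x, y} \<in> E'" "connected_in (E' - {{x, y}}) x y"
    using cycle_closing_edge[OF ps(1,2)] ps(3) by (auto simp: x_def y_def insert_commute)
  have "\<exists>z. {x, z} \<in> E' \<and> z \<noteq> y"
    using xy(3,1) by (cases rule: converse_rtranclpE) auto
  moreover have "\<exists>z. {y, z} \<in> E' \<and> z \<noteq> x"
    using xy(3,1) by (cases rule: rtranclp.cases) (auto simp: insert_commute)
  ultimately obtain c d where cd: "{c, d} \<in> E" "c \<noteq> d"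
      "connected_in (E - {{c, d}}) c (g x)" "connected_in (E - {{c, d}}) (g y) d"
      "\<And>x' y'. {x', y'} \<in> E' \<Longrightarrow> {x', y'} \<noteq> {x, y} \<Longrightarrow>
          connected_in (E - {{c, d}}) (g x') (g y')"
    using edge[OF xy(2,1)] by blast
  from xy(3) have "connected_in (E - {{c, d}}) (g x) (g y)"
    by (induction rule: rtranclp_induct) (use cd(5) in \<open>auto intro: rtranclp_trans\<close>)
  then have "connected_in (E - {{c, d}}) c d"
    using cd(3,4) by (meson rtranclp_trans)
  with acyclic_graph_bridge[OF ac cd(1,2)] show False by blast
qed

section \<open>Nodes of a forest\<close>

text \<open>
  The empty position, which is not a node, serves as the parent of all roots, so that roots and
  successors are treated uniformly.
\<close>

definition child_labels :: "('v, 'p) forest \<Rightarrow> node \<Rightarrow> 'v label list" where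
  "child_labels G p = (if p = [] then map root_label G
    else case node_at G p of None \<Rightarrow> [] | Some l \<Rightarrow> children l)"

lemma descend_snoc:
  "p \<noteq> [] \<Longrightarrow> descend ls (p @ [i]) =
    (case descend ls p of None \<Rightarrow> None
     | Some l \<Rightarrow> if i < length (children l) then Some (children l ! i) else None)"
  by (induction ls p rule: descend.induct) auto

lemma node_at_Nil [simp]: "node_at G [] = None"
  by (simp add: node_at_def)

lemma node_at_snoc:
  "node_at G (p @ [i]) =
    (if i < length (child_labels G p) then Some (child_labels G p ! i) else None)"
  by (cases "p = []") (auto simp: child_labels_def node_at_def descend_snoc split: option.splits)

lemma nodes_snoc: "p @ [i] \<in> nodes G \<longleftrightarrow> i < length (child_labels G p)"
  by (simp add: nodes_def node_at_snoc)

lemma successor_snoc: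
  "successor G p q \<longleftrightarrow> (\<exists>i. q = p @ [i] \<and> p \<noteq> [] \<and> i < length (child_labels G p))"
  by (auto simp: successor_def nodes_snoc) (auto simp: nodes_def child_labels_def split: option.splits)

lemma Nil_not_node [simp]: "[] \<notin> nodes G"
  by (simp add: nodes_def)

lemma nodes_snocD: "p @ [i] \<in> nodes G \<Longrightarrow> p \<noteq> [] \<Longrightarrow> p \<in> nodes G"
  by (auto simp: nodes_snoc) (auto simp: nodes_def child_labels_def split: option.splits)

lemma nodes_prefix: "prefix p q \<Longrightarrow> q \<in> nodes G \<Longrightarrow> p \<noteq> [] \<Longrightarrow> p \<in> nodes G"
proof (induction q rule: rev_induct)
  case (snoc i q)
  then show ?case using nodes_snocD[of q i G]
    by (cases "p = q @ [i]"; cases "q = []") (auto simp: prefix_Cons)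
qed simp

lemma node_at_child:
  "node_at G p = Some l \<Longrightarrow> i < length (children l) \<Longrightarrow> node_at G (p @ [i]) = Some (children l ! i)"
  by (cases "p = []") (auto simp: node_at_snoc child_labels_def)

lemma switched_ne_Nil: "switched G p \<Longrightarrow> p \<noteq> []"
  by (auto simp: switched_def is_expansion_def)

lemma switching_graph_cases:
  assumes "{x, y} \<in> switching_graph G \<sigma>"
  obtains p q where "{x, y} = {q, p}" "successor G p q" "switched G p \<longrightarrow> \<sigma> p = q"
    | p q where "{x, y} = {p, q}" "axiom_link G p q"
  using assms unfolding switching_graph_def by blast

lemma switching_graph_in_nodes:
  assumes "{x, y} \<in> switching_graph G \<sigma>"
  shows "x \<in> nodes G \<and> y \<in> nodes G"
  using assms
proof (cases rule: switching_graph_cases)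
  case (1 p q)
  then show ?thesis by (auto simp: successor_def doubleton_eq_iff)
next
  case (2 p q)
  then show ?thesis by (auto simp: axiom_link_def nodes_def doubleton_eq_iff)
qed

lemma descend_Cons:
  "descend ls (i # p) = (if i < length ls then
    (if p = [] then Some (ls ! i) else descend (children (ls ! i)) p) else None)"
  by (cases p) auto

lemma node_at_append_left: "i < length F \<Longrightarrow> node_at (F @ X) (i # p) = node_at F (i # p)"
  by (simp add: node_at_def descend_Cons nth_append)

lemma node_at_last_root:
  "node_at (F @ [r]) (length F # p) = (if p = [] then Some (root_label r)
    else descend (children (root_label r)) p)"
  by (simp add: node_at_def descend_Cons nth_append)

section \<open>Substructures\<close>

lemma substructureD:
  assumes "substructure G H"
  shows "H \<subseteq> nodes G"
    and "p \<in> H \<Longrightarrow> successor G p q \<Longrightarrow> q \<in> H"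
    and "p \<in> H \<Longrightarrow> axiom_link G p q \<Longrightarrow> q \<in> H"
    and "q \<in> H \<Longrightarrow> node_at G q = Some StarLabel \<Longrightarrow> successor G p q \<Longrightarrow> p \<in> H"
  using assms unfolding substructure_def by blast+

lemma substructure_prefix:
  assumes "substructure G H" "p \<in> H" "prefix p q" "q \<in> nodes G"
  shows "q \<in> H"
  using assms(3,4)
proof (induction q rule: rev_induct)
  case (snoc i q)
  have "p \<noteq> []" using substructureD(1)[OF assms(1)] assms(2) by auto
  show ?case
  proof (cases "p = q @ [i]")
    case False
    with snoc.prems have "prefix p q" by simp
    with \<open>p \<noteq> []\<close> have "q \<in> nodes G" using nodes_snocD[OF snoc.prems(2)]
      by (cases "q = []") auto
    with \<open>prefix p q\<close> have "q \<in> H" using snoc.IH by blast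
    with \<open>q \<in> nodes G\<close> snoc.prems(2) show ?thesis
      using substructureD(2)[OF assms(1)] unfolding successor_def by blast
  qed (use assms in simp)
qed (use assms substructureD(1)[OF assms(1)] in auto)

text \<open>
  Together with closure under successors, this says that a substructure consists of the nodes
  below its roots.
\<close>

lemma substructure_root_above:
  assumes "substructure G H" "q \<in> H"
  shows "\<exists>u \<in> roots G H. prefix u q"
  using assms(2)
proof (induction q rule: rev_induct)
  case (snoc i q)
  show ?case
  proof (cases "q \<in> H")
    case True
    with snoc show ?thesis by auto
  next
    case False
    with snoc have "q @ [i] \<in> roots G H" by (auto simp: roots_def successor_def)
    then show ?thesis by blast
  qed
qed (use assms substructureD(1)[OF assms(1)] in auto)

lemma root_prefix_not_in:
  assumes "substructure G H" "u \<in> roots G H" "strict_prefix p u"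
  shows "p \<notin> H"
proof
  assume "p \<in> H"
  from assms(3) have "u \<noteq> []" by auto
  then obtain q i where u: "u = q @ [i]" by (metis rev_exhaust)
  have "u \<in> nodes G" "p \<noteq> []"
    using assms(2) substructureD(1)[OF assms(1)] \<open>p \<in> H\<close> by (auto simp: roots_def)
  moreover from this have "q \<in> nodes G"
    using assms(3) nodes_snocD[of q i G] by (cases "q = []") (auto simp: u strict_prefix_def prefix_Cons)
  moreover have "prefix p q" using assms(3) by (auto simp: u strict_prefix_def)
  ultimately have "q \<in> H" using substructure_prefix[OF assms(1) \<open>p \<in> H\<close>] by blast
  with \<open>u \<in> nodes G\<close> \<open>q \<in> nodes G\<close> assms(2) show False
    unfolding u roots_def successor_def by blast
qed

section \<open>Typed terms and the existence of switchings\<close>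

lemma typing_inversions:
  "tree_typing \<Gamma> (Expansion ws) A \<Longrightarrow>
    ws \<noteq> [] \<and> (\<forall>w \<in> set ws. \<exists>W. wit_typing \<Gamma> w W)"
  "tree_typing \<Gamma> (Disj t s) A \<Longrightarrow> (\<exists>B. tree_typing \<Gamma> t B) \<and> (\<exists>B. tree_typing \<Gamma> s B)"
  "tree_typing \<Gamma> (WeakR t) A \<Longrightarrow> \<exists>B. tree_typing \<Gamma> t B"
  "tree_typing \<Gamma> (WeakL t) A \<Longrightarrow> \<exists>B. tree_typing \<Gamma> t B"
  "wit_typing \<Gamma> (Tensor t s) W \<Longrightarrow> (\<exists>B. tree_typing \<Gamma> t B) \<and> (\<exists>B. tree_typing \<Gamma> s B)"
  by (auto elim: tree_typing.cases wit_typing.cases)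

primrec label_typable :: "('v \<Rightarrow> 'p) \<Rightarrow> 'v label \<Rightarrow> bool" where
  "label_typable \<Gamma> (TreeLabel t) \<longleftrightarrow> (\<exists>A. tree_typing \<Gamma> t A)"
| "label_typable \<Gamma> (WitLabel w) \<longleftrightarrow> (\<exists>W. wit_typing \<Gamma> w W)"
| "label_typable \<Gamma> StarLabel \<longleftrightarrow> True"
| "label_typable \<Gamma> (CutLabel t s) \<longleftrightarrow> (\<exists>A. tree_typing \<Gamma> t A) \<and> (\<exists>A. tree_typing \<Gamma> s A)"

lemma label_typable_children:
  "label_typable \<Gamma> l \<Longrightarrow> l' \<in> set (children l) \<Longrightarrow> label_typable \<Gamma> l'"
  by (cases l rule: children.cases) (auto dest: typing_inversions)

lemma label_typable_node:
  assumes "\<forall>r \<in> set G. root_typing \<Gamma> r" "node_at G p = Some l"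
  shows "label_typable \<Gamma> l"
  using assms(2)
proof (induction p arbitrary: l rule: rev_induct)
  case (snoc i p)
  then have l: "l \<in> set (child_labels G p)"
    by (auto simp: node_at_snoc split: if_splits)
  show ?case
  proof (cases "p = []")
    case True
    with l obtain r where "r \<in> set G" "l = root_label r" by (auto simp: child_labels_def)
    with assms(1) have "root_typing \<Gamma> r" by blast
    with \<open>l = root_label r\<close> show ?thesis by (cases r) auto
  next
    case False
    with l obtain l0 where "node_at G p = Some l0" "l \<in> set (children l0)"
      by (cases "node_at G p") (auto simp: child_labels_def)
    with snoc.IH show ?thesis by (blast intro: label_typable_children)
  qed
qed simp

text \<open>
  Acyclicity of all switching graphs would hold vacuously if some expansion were empty; typing
  excludes this.
\<close>

lemma switching_exists:
  assumes "\<forall>r \<in> set G. root_typing \<Gamma> r"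
  shows "\<exists>\<sigma>. switching G \<sigma>"
proof -
  have "successor G p (p @ [0])" if "switched G p" for p
  proof -
    from that obtain l where l: "node_at G p = Some l"
        "(\<exists>ws. l = TreeLabel (Expansion ws)) \<or> (\<exists>t s. l = TreeLabel (Disj t s))"
      by (auto simp: switched_def is_expansion_def)
    have "label_typable \<Gamma> l" by (rule label_typable_node[OF assms l(1)])
    with l(2) have "children l \<noteq> []" by (auto dest: typing_inversions)
    moreover have "p \<noteq> []" using l(1) by auto
    ultimately show ?thesis using l(1) by (auto simp: successor_snoc child_labels_def)
  qed
  then have "switching G (\<lambda>p. p @ [0])" by (simp add: switching_def)
  then show ?thesis by blast
qed

section \<open>Forks between the roots of a subnet\<close>

lemma inj_on_take: "inj_on (\<lambda>k. take k xs) {..length xs}"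
  by (rule inj_onI) (metis atMost_iff length_take min_absorb2)

text \<open>
  The path climbs from one node to \<open>c\<close> and descends to the other one.  Above \<open>c\<close> the two branches
  agree and below \<open>c\<close> they are disjoint, so a switching can follow both of them unless it has to
  choose at \<open>c\<close> itself.
\<close>

lemma fork_switching_path:
  assumes sw: "switching G \<tau>"
    and nodes: "c @ i # a \<in> nodes G" "c @ j # b \<in> nodes G"
    and "i \<noteq> j" "c \<noteq> []" "\<not> switched G c"
  shows "\<exists>ps. switching_path G ps \<and> ps \<noteq> [] \<and> hd ps = c @ i # a \<and> last ps = c @ j # b \<and> c \<in> set ps"
proof -
  define p q where "p = c @ i # a" and "q = c @ j # b"
  define n where "n = length c"
  have nodes': "p \<in> nodes G" "q \<in> nodes G"
    using nodes by (simp_all add: p_def q_def)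
  have n: "take n p = c" "take n q = c" "n < length p" "n < length q" "n \<noteq> 0"
    using \<open>c \<noteq> []\<close> by (auto simp: n_def p_def q_def)
  have fork: "p ! n \<noteq> q ! n" using \<open>i \<noteq> j\<close> by (simp add: n_def p_def q_def)
  define \<sigma> where "\<sigma> x = (if strict_prefix x p then take (Suc (length x)) p
     else if strict_prefix x q then take (Suc (length x)) q else \<tau> x)" for x
  have succ: "successor G (take k y) (take (Suc k) y)"
    if "k < length y" "k \<noteq> 0" "y \<in> nodes G" for k y
  proof -
    have "take k y \<in> nodes G" "take (Suc k) y \<in> nodes G"
      using that by (auto intro!: nodes_prefix[OF take_is_prefix])
    then show ?thesis using that(1) by (auto simp: successor_def take_Suc_conv_app_nth)
  qed
  have strict: "strict_prefix x y \<Longrightarrow> x = take (length x) y \<and> length x < length y" for x y :: node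
    by (auto simp: strict_prefix_def prefix_def)
  have strict_take: "strict_prefix (take k y) y" if "k < length y" for k and y :: node
    using that by (auto simp: strict_prefix_def take_is_prefix)
  have "switching G \<sigma>"
    unfolding switching_def
  proof (intro allI impI)
    fix x assume "switched G x"
    then have "x \<noteq> []" by (rule switched_ne_Nil)
    have along: "successor G x (take (Suc (length x)) y)"
      if "strict_prefix x y" "y \<in> nodes G" for y
      using succ[of "length x" y] strict[OF that(1)] that(2) \<open>x \<noteq> []\<close> by (metis length_0_conv)
    show "successor G x (\<sigma> x)"
      unfolding \<sigma>_def using along nodes' sw \<open>switched G x\<close> by (simp add: switching_def)
  qed
  let ?R = "\<lambda>x y. {x, y} \<in> switching_graph G \<sigma>"
  have up: "{take (Suc k) p, take k p} \<in> switching_graph G \<sigma>" if "k < length p" "k \<noteq> 0" for k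
  proof -
    have "\<sigma> (take k p) = take (Suc k) p"
      unfolding \<sigma>_def using strict_take[OF that(1)] that(1) by (simp add: min_absorb2)
    with succ[OF that nodes'(1)] show ?thesis unfolding switching_graph_def by blast
  qed
  have down: "{take k q, take (Suc k) q} \<in> switching_graph G \<sigma>" if "k < length q" "n \<le> k" for k
  proof -
    have "switched G (take k q) \<longrightarrow> \<sigma> (take k q) = take (Suc k) q"
    proof (cases "k = n")
      case True
      then show ?thesis using n \<open>\<not> switched G c\<close> by simp
    next
      case False
      have "\<not> strict_prefix (take k q) p"
      proof
        assume "strict_prefix (take k q) p"
        then have "take k q = take k p" using strict[of "take k q" p] that(1)
          by (simp add: min_absorb2)
        with fork False that(2) show False by (metis nth_take le_neq_implies_less)
      qed
      then show ?thesis
        unfolding \<sigma>_def using strict_take[OF that(1)] that(1) by (simp add: min_absorb2)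
    qed
    moreover have "k \<noteq> 0" using that(2) n(5) by simp
    ultimately have "{take (Suc k) q, take k q} \<in> switching_graph G \<sigma>"
      using succ[OF that(1) _ nodes'(2)] unfolding switching_graph_def by blast
    then show ?thesis by (simp add: insert_commute)
  qed
  define us where "us = map (\<lambda>k. take k p) [n..<Suc (length p)]"
  define ds where "ds = map (\<lambda>k. take k q) [Suc n..<Suc (length q)]"
  have ends: "us \<noteq> []" "ds \<noteq> []" "hd us = c" "last us = p" "hd ds = take (Suc n) q" "last ds = q"
    using n by (auto simp: us_def ds_def hd_map last_map simp del: upt_Suc)
  have "distinct us" "distinct ds"
    by (auto simp: us_def ds_def distinct_map simp del: upt_Suc
        intro!: inj_on_subset[OF inj_on_take])
  moreover have "take k p \<noteq> take k' q" if "n \<le> k" "k \<le> length p" "n < k'" "k' \<le> length q" for k k'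
  proof
    assume eq: "take k p = take k' q"
    then have "length (take k p) = length (take k' q)" by (rule arg_cong)
    then have "k = k'" using that by (simp only: length_take min_absorb2)
    with eq that(3) fork show False by (metis nth_take)
  qed
  then have "set us \<inter> set ds = {}"
    by (auto simp: us_def ds_def simp del: upt_Suc)
  ultimately have "distinct (rev us @ ds)" by auto
  moreover have "successively ?R (rev us)"
    unfolding successively_rev us_def successively_map
    using up n(5) by (auto simp: successively_conv_nth simp del: upt_Suc)
  moreover have "successively ?R ds"
    unfolding ds_def successively_map
    using down by (auto simp: successively_conv_nth simp del: upt_Suc)
  moreover have "?R (last (rev us)) (hd ds)"
    using down[of n] n ends by (simp add: last_rev)
  ultimately have "path (switching_graph G \<sigma>) (rev us @ ds)"
    using ends by (simp add: path_def successively_append_iff)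
  moreover have "set (rev us @ ds) \<subseteq> nodes G"
    using nodes' n(5) by (auto simp: us_def ds_def intro!: nodes_prefix[OF take_is_prefix])
  ultimately have "switching_path G (rev us @ ds)"
    unfolding switching_path_def using \<open>switching G \<sigma>\<close> by blast
  moreover have "c \<in> set (rev us @ ds)" using ends by (metis UnCI hd_in_set set_append set_rev)
  ultimately show ?thesis
    using ends by (intro exI[of _ "rev us @ ds"]) (simp add: hd_rev hd_append p_def q_def)
qed

text \<open>
  The path between the two roots through \<open>c\<close> would have to stay inside the subnet, but \<open>c\<close> lies
  above a root and hence outside.
\<close>

lemma subnet_fork_switched:
  assumes "subnet G H" "switching G \<tau>"
    and roots: "c @ i # a \<in> roots G H" "c @ j # b \<in> roots G H"
    and "i \<noteq> j" "c \<noteq> []"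
  shows "switched G c"
proof (rule ccontr)
  assume "\<not> switched G c"
  have sub: "substructure G H" using assms(1) by (simp add: subnet_def)
  have "c @ i # a \<in> nodes G" "c @ j # b \<in> nodes G"
    using roots substructureD(1)[OF sub] by (auto simp: roots_def)
  with fork_switching_path[OF assms(2) _ _ \<open>i \<noteq> j\<close> \<open>c \<noteq> []\<close> \<open>\<not> switched G c\<close>] obtain ps where
    "switching_path G ps" "ps \<noteq> []" "hd ps = c @ i # a" "last ps = c @ j # b" "c \<in> set ps"
    by blast
  with assms(1) roots have "c \<in> H" by (auto simp: subnet_def)
  moreover have "strict_prefix c (c @ i # a)" by (simp add: strict_prefix_def)
  ultimately show False using root_prefix_not_in[OF sub roots(1)] by blast
qed

section \<open>Contracting the cut\<close>

text \<open>
  The position in the redex of a node of the reduct, where \<open>n\<close> is the position of the cut.  The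
  subtrees \<open>s1\<close> and \<open>t\<close> sit deeper in the redex.  The cut itself is sent to the tensor, one of the
  inner nodes of the path from \<open>s1\<close> to \<open>t\<close>: then all edges but that from the cut to \<open>t\<close> are
  mapped to single edges.
\<close>

fun cut_origin :: "nat \<Rightarrow> node \<Rightarrow> node" where
  "cut_origin n [] = []"
| "cut_origin n [i] = (if i = n then [n, 0, 0] else [i])"
| "cut_origin n (i # j # p) = (if i \<noteq> n then i # j # p
    else if j = 0 then n # 0 # 0 # 0 # p else n # 1 # 0 # p)"

lemma cut_origin_snoc:
  "p \<noteq> [] \<Longrightarrow> p \<noteq> [n] \<or> k = 0 \<Longrightarrow> cut_origin n (p @ [k]) = cut_origin n p @ [k]"
  by (cases "(n, p)" rule: cut_origin.cases) auto

lemma cut_origin_avoids: "cut_origin n p \<notin> {[n], [n, 0], [n, 1]}"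
  by (cases "(n, p)" rule: cut_origin.cases) auto

lemma cut_origin_other: "hd p \<noteq> n \<Longrightarrow> cut_origin n p = p"
  by (cases "(n, p)" rule: cut_origin.cases) auto

locale cut_reduction =
  fixes F :: "('v, 'p) forest" and s1 s2 t :: "'v tree" and A C :: "'p formula"
    and n :: nat and G R :: "('v, 'p) forest"
  defines "n \<equiv> length F"
    and "G \<equiv> F @ [Cut (Expansion [Tensor s1 s2]) (WeakR t) C]"
    and "R \<equiv> F @ [Cut s1 t A]"
begin

lemma redex_nodes:
  "node_at G [n] = Some (CutLabel (Expansion [Tensor s1 s2]) (WeakR t))"
  "node_at G [n, 0] = Some (TreeLabel (Expansion [Tensor s1 s2]))"
  "node_at G [n, 0, 0] = Some (WitLabel (Tensor s1 s2))"
  "node_at G [n, 1] = Some (TreeLabel (WeakR t))"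
  "node_at G [n, 1, 0] = Some (TreeLabel t)"
  "node_at R [n] = Some (CutLabel s1 t)"
  by (simp_all add: G_def R_def n_def node_at_last_root descend_Cons)

lemma node_range: "i # p \<in> nodes R \<Longrightarrow> i \<le> n"
  by (auto simp: nodes_def R_def n_def node_at_def descend_Cons split: if_splits)

lemma reduct_cut_children: "n # j # p \<in> nodes R \<Longrightarrow> j < 2"
  by (auto simp: nodes_def R_def n_def node_at_last_root descend_Cons split: if_splits)

lemma node_at_cut_origin:
  assumes "p \<in> nodes R" "p \<noteq> [n]"
  shows "node_at G (cut_origin n p) = node_at R p"
proof (cases "(n, p)" rule: cut_origin.cases)
  case (2 n' i)
  then show ?thesis using assms node_range[of i "[]"]
    by (simp add: G_def R_def n_def node_at_append_left)
next
  case (3 n' i j r)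
  then show ?thesis
  proof (cases "i = n")
    case True
    with 3 reduct_cut_children assms(1) have "j = 0 \<or> j = 1" by fastforce
    with 3 True show ?thesis
      by (auto simp: G_def R_def n_def node_at_last_root descend_Cons)
  next
    case False
    with 3 assms(1) have "i < n" using node_range[of i "j # r"] by simp
    with 3 False show ?thesis by (simp add: G_def R_def n_def node_at_append_left)
  qed
qed (use assms in simp)

lemma cut_origin_node: "p \<in> nodes R \<Longrightarrow> cut_origin n p \<in> nodes G"
  using node_at_cut_origin[of p] redex_nodes by (cases "p = [n]") (auto simp: nodes_def)

lemma inj_cut_origin: "inj_on (cut_origin n) (nodes R)"
proof (rule inj_onI)
  fix p q assume *: "p \<in> nodes R" "q \<in> nodes R" "cut_origin n p = cut_origin n q"
  then show "p = q"
    using reduct_cut_children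
    by (cases "(n, p)" rule: cut_origin.cases; cases "(n, q)" rule: cut_origin.cases)
      (auto split: if_splits dest!: less_2_cases)
qed

lemma switched_cut_origin: "p \<in> nodes R \<Longrightarrow> switched G (cut_origin n p) \<longleftrightarrow> switched R p"
  using node_at_cut_origin[of p] redex_nodes
  by (cases "p = [n]") (auto simp: switched_def is_expansion_def)

lemma successor_cut_origin:
  assumes "successor R p q" "q \<noteq> [n, 1]"
  shows "successor G (cut_origin n p) (cut_origin n q)"
proof -
  from assms(1) obtain k where q: "q = p @ [k]" "p \<noteq> []" and nodes: "p \<in> nodes R" "q \<in> nodes R"
    by (metis Nil_not_node successor_def)
  have "p \<noteq> [n] \<or> k = 0"
    using assms(2) nodes(2) reduct_cut_children[of k "[]"] by (auto simp: q)
  then have "cut_origin n q = cut_origin n p @ [k]"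
    using cut_origin_snoc[OF q(2)] by (simp add: q)
  then show ?thesis
    using cut_origin_node[OF nodes(1)] cut_origin_node[OF nodes(2)] by (simp add: successor_def)
qed

lemma axiom_link_cut_origin:
  assumes "axiom_link R p q"
  shows "axiom_link G (cut_origin n p) (cut_origin n q)"
proof -
  have "p \<in> nodes R" "q \<in> nodes R" "p \<noteq> [n]" "q \<noteq> [n]"
    using assms redex_nodes(6) by (auto simp: axiom_link_def nodes_def)
  with assms show ?thesis by (simp add: axiom_link_def node_at_cut_origin)
qed

lemma node_at_unchanged: "p \<noteq> [] \<Longrightarrow> hd p \<noteq> n \<Longrightarrow> node_at G p = node_at R p"
  by (cases p)
    (auto simp: G_def R_def n_def node_at_def descend_Cons nth_append)

lemma hd_cut_origin: "hd (cut_origin n p) = hd p"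
  by (cases "(n, p)" rule: cut_origin.cases) auto

lemma cut_origin_not_in_discarded: "\<not> prefix [n, 0, 0, 1] (cut_origin n p)"
  by (cases "(n, p)" rule: cut_origin.cases) auto

text \<open>
  The exceptions are the inner nodes of the path from \<open>s1\<close> to \<open>t\<close> other than the tensor, the
  \<open>*\<close> of the weakening, and the subtree \<open>s2\<close>.
\<close>

lemma cut_origin_surj:
  assumes "r \<in> nodes G" "r \<notin> {[n], [n, 0], [n, 1], [n, 1, 1]}" "\<not> prefix [n, 0, 0, 1] r"
  shows "\<exists>q \<in> nodes R. cut_origin n q = r"
proof -
  obtain i r1 where r: "r = i # r1" using assms(1) by (cases r) auto
  show ?thesis
  proof (cases "i = n")
    case False
    then have "r \<in> nodes R" using assms(1) node_at_unchanged[of r] by (simp add: r nodes_def)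
    with False show ?thesis using cut_origin_other[of r n] r by force
  next
    case True
    with assms(2) obtain j r2 where r1: "r1 = j # r2" using r by (cases r1) auto
    have "j < 2" using assms(1)
      by (auto simp: r r1 True nodes_def G_def n_def node_at_last_root descend_Cons split: if_splits)
    then consider "j = 0" | "j = 1" by linarith
    then show ?thesis
    proof cases
      case 1
      with assms(2) r r1 True obtain k r3 where r2: "r2 = k # r3" by (cases r2) auto
      have "k = 0" using assms(1)
        by (auto simp: r r1 r2 1 True nodes_def G_def n_def node_at_last_root descend_Cons split: if_splits)
      show ?thesis
      proof (cases r3)
        case Nil
        with r r1 r2 1 True \<open>k = 0\<close> redex_nodes(6) show ?thesis
          by (intro bexI[of _ "[n]"]) (auto simp: nodes_def)
      next
        case (Cons m r4)
        have "m < 2" using assms(1)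
          by (auto simp: r r1 r2 1 Cons \<open>k = 0\<close> True nodes_def G_def n_def node_at_last_root
              descend_Cons split: if_splits)
        with assms(3) r r1 r2 1 True \<open>k = 0\<close> Cons have "m = 0" by (auto simp: less_2_cases_iff)
        have "n # 0 # r4 \<in> nodes R" using assms(1)
          by (auto simp: r r1 r2 1 Cons \<open>k = 0\<close> \<open>m = 0\<close> True nodes_def G_def R_def n_def
              node_at_last_root descend_Cons split: if_splits)
        then show ?thesis
          using r r1 r2 1 True \<open>k = 0\<close> Cons \<open>m = 0\<close> by (intro bexI[of _ "n # 0 # r4"]) auto
      qed
    next
      case 2
      with assms(2) r r1 True obtain k r3 where r2: "r2 = k # r3" by (cases r2) auto
      have k: "k = 0" using assms(1,2)
        by (cases r3) (auto simp: r r1 r2 2 True nodes_def G_def n_def node_at_last_root descend_Cons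
            less_Suc_eq split: if_splits)
      have "n # 1 # r3 \<in> nodes R" using assms(1)
        by (auto simp: r r1 r2 2 k True nodes_def G_def R_def n_def
            node_at_last_root descend_Cons split: if_splits)
      then show ?thesis
        using r r1 r2 2 True k by (intro bexI[of _ "n # 1 # r3"]) auto
    qed
  qed
qed

text \<open>
  A switching graph of the reduct becomes part of one of the redex when the link from the cut to
  \<open>t\<close> is stretched to the path tensor, expansion, cut, weakening, \<open>t\<close>.  This path is present under
  every switching because its only switched node is an expansion with a single summand.
\<close>

lemma AC_reduct:
  assumes "switching G \<tau>" "AC G"
  shows "AC R"
  unfolding AC_def
proof (intro allI impI)
  fix \<sigma>' assume \<sigma>': "switching R \<sigma>'"
  let ?f = "cut_origin n"
  define \<sigma> where "\<sigma> q = (if q \<in> ?f ` nodes R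
    then ?f (\<sigma>' (the_inv_into (nodes R) ?f q)) else \<tau> q)" for q
  have \<sigma>_origin: "\<sigma> (?f p) = ?f (\<sigma>' p)" if "p \<in> nodes R" for p
    using that by (simp add: \<sigma>_def the_inv_into_f_f[OF inj_cut_origin])
  have "switching G \<sigma>"
    unfolding switching_def
  proof (intro allI impI)
    fix q assume q: "switched G q"
    show "successor G q (\<sigma> q)"
    proof (cases "q \<in> ?f ` nodes R")
      case True
      then obtain p where p: "p \<in> nodes R" "q = ?f p" by blast
      with q have "switched R p" using switched_cut_origin by simp
      with \<sigma>' have succ: "successor R p (\<sigma>' p)" by (simp add: switching_def)
      moreover have "p \<noteq> [n]"
        using \<open>switched R p\<close> redex_nodes(6) by (auto simp: switched_def is_expansion_def)
      then have "\<sigma>' p \<noteq> [n, 1]" using succ by (auto simp: successor_def)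
      ultimately show ?thesis using p by (simp add: \<sigma>_origin successor_cut_origin)
    qed (use assms(1) q in \<open>simp add: switching_def \<sigma>_def\<close>)
  qed
  define E where "E = switching_graph G \<sigma>"
  define E' where "E' = switching_graph R \<sigma>'"
  have "acyclic_graph E"
    using \<open>switching G \<sigma>\<close> assms(2) by (simp add: AC_def E_def)
  have mapped: "{?f x, ?f y} \<in> E" if "{x, y} \<in> E'" "{x, y} \<noteq> {[n], [n, 1]}" for x y
    using that(1) unfolding E'_def
  proof (cases rule: switching_graph_cases)
    case (1 p q)
    have "q \<noteq> [n, 1]"
    proof
      assume "q = [n, 1]"
      with 1(2) have "p = [n]" by (auto simp: successor_def)
      with \<open>q = [n, 1]\<close> 1(1) that(2) show False by (simp add: insert_commute)
    qed
    with 1(2) have succ: "successor G (?f p) (?f q)" by (rule successor_cut_origin)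
    have "p \<in> nodes R" using 1(2) by (simp add: successor_def)
    with 1(3) have "switched G (?f p) \<longrightarrow> \<sigma> (?f p) = ?f q"
      by (auto simp: switched_cut_origin \<sigma>_origin)
    with succ have "{?f q, ?f p} \<in> E" unfolding E_def switching_graph_def by blast
    with 1(1) show ?thesis by (auto simp: doubleton_eq_iff insert_commute)
  next
    case (2 p q)
    then have "{?f p, ?f q} \<in> E"
      using axiom_link_cut_origin unfolding E_def switching_graph_def by blast
    with 2(1) show ?thesis by (auto simp: doubleton_eq_iff insert_commute)
  qed
  have redex_edges: "{[n, 0, 0], [n, 0]} \<in> E" "{[n, 0], [n]} \<in> E" "{[n, 1], [n]} \<in> E"
      "{[n, 1, 0], [n, 1]} \<in> E"
  proof -
    have "switched G [n, 0]" "\<not> switched G [n]" "\<not> switched G [n, 1]"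
      using redex_nodes by (auto simp: switched_def is_expansion_def)
    moreover from this \<open>switching G \<sigma>\<close> have "successor G [n, 0] (\<sigma> [n, 0])"
      by (simp add: switching_def)
    then have "\<sigma> [n, 0] = [n, 0, 0]"
      using redex_nodes(2) by (auto simp: successor_snoc child_labels_def)
    moreover have "successor G [n, 0] [n, 0, 0]" "successor G [n] [n, 0]" "successor G [n] [n, 1]"
        "successor G [n, 1] [n, 1, 0]"
      using redex_nodes by (auto simp: successor_def nodes_def)
    ultimately show "{[n, 0, 0], [n, 0]} \<in> E" "{[n, 0], [n]} \<in> E" "{[n, 1], [n]} \<in> E"
        "{[n, 1, 0], [n, 1]} \<in> E"
      unfolding E_def switching_graph_def by blast+
  qed
  \<comment> \<open>Each of these edges has an end that is not the origin of a node of the reduct, so the path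
    also avoids every edge that joins two origins.\<close>
  have detour: "connected_in (E - {e}) [n, 0, 0] [n, 1]"
    if "e \<notin> {{[n, 0, 0], [n, 0]}, {[n, 0], [n]}, {[n, 1], [n]}}" for e
  proof -
    have "{[n, 0, 0], [n, 0]} \<in> E - {e}" "{[n, 0], [n]} \<in> E - {e}" "{[n], [n, 1]} \<in> E - {e}"
      using redex_edges that by (auto simp: insert_commute)
    then show ?thesis by (meson converse_rtranclp_into_rtranclp rtranclp.rtrancl_refl)
  qed
  show "acyclic_graph (switching_graph R \<sigma>')"
    unfolding E'_def[symmetric]
  proof (rule acyclic_graph_pullback[OF \<open>acyclic_graph E\<close>, where g = ?f], intro disjI2)
    fix x y assume xy: "{x, y} \<in> E'" "x \<noteq> y"
    have nodes: "u \<in> nodes R \<and> v \<in> nodes R" if "{u, v} \<in> E'" for u v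
      using that unfolding E'_def by (rule switching_graph_in_nodes)
    note inj = inj_on_eq_iff[OF inj_cut_origin]
    show "\<exists>c d. {c, d} \<in> E \<and> c \<noteq> d \<and>
        connected_in (E - {{c, d}}) c (?f x) \<and> connected_in (E - {{c, d}}) (?f y) d \<and>
        (\<forall>x' y'. {x', y'} \<in> E' \<and> {x', y'} \<noteq> {x, y} \<longrightarrow>
          connected_in (E - {{c, d}}) (?f x') (?f y'))"
    proof (cases "{x, y} = {[n], [n, 1]}")
      case False
      let ?e = "{?f x, ?f y}"
      have "connected_in (E - {?e}) [n, 0, 0] [n, 1]"
        using cut_origin_avoids[of n] by (intro detour) (auto simp: doubleton_eq_iff)
      moreover have "{[n, 1], [n, 1, 0]} \<in> E - {?e}"
        using redex_edges(4) cut_origin_avoids[of n x] cut_origin_avoids[of n y]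
        by (auto simp: doubleton_eq_iff insert_commute)
      ultimately have cut: "connected_in (E - {?e}) [n, 0, 0] [n, 1, 0]"
        by (rule rtranclp.rtrancl_into_rtrancl)
      have "connected_in (E - {?e}) (?f x') (?f y')"
        if x'y': "{x', y'} \<in> E'" "{x', y'} \<noteq> {x, y}" for x' y'
      proof (cases "{x', y'} = {[n], [n, 1]}")
        case True
        then show ?thesis
          using cut connected_in_sym[OF cut] by (auto simp: doubleton_eq_iff)
      next
        case False
        have "{?f x', ?f y'} \<noteq> ?e"
          using x'y'(2) nodes[OF xy(1)] nodes[OF x'y'(1)] by (auto simp: doubleton_eq_iff inj)
        with mapped[OF x'y'(1) False] show ?thesis by blast
      qed
      then show ?thesis
        using mapped[OF xy(1) False] xy(2) nodes[OF xy(1)] inj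
        by (intro exI[of _ "?f x"] exI[of _ "?f y"]) auto
    next
      case True
      let ?e = "{[n, 1], [n, 1, 0]}"
      have cut: "connected_in (E - {?e}) [n, 0, 0] [n, 1]"
        by (rule detour) (auto simp: doubleton_eq_iff)
      have rest: "connected_in (E - {?e}) (?f x') (?f y')"
        if x'y': "{x', y'} \<in> E'" "{x', y'} \<noteq> {x, y}" for x' y'
      proof -
        have "{?f x', ?f y'} \<noteq> ?e"
          using cut_origin_avoids[of n] by (auto simp: doubleton_eq_iff)
        with mapped[OF x'y'(1)] x'y'(2) True show ?thesis by blast
      qed
      from True consider "x = [n]" "y = [n, 1]" | "x = [n, 1]" "y = [n]"
        by (auto simp: doubleton_eq_iff)
      then show ?thesis
      proof cases
        case 1
        with rest connected_in_sym[OF cut] redex_edges(4) show ?thesis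
          by (intro exI[of _ "[n, 1]"] exI[of _ "[n, 1, 0]"]) (auto simp: insert_commute)
      next
        case 2
        with rest cut redex_edges(4) show ?thesis
          by (intro exI[of _ "[n, 1, 0]"] exI[of _ "[n, 1]"]) (auto simp: insert_commute)
      qed
    qed
  qed
qed

text \<open>
  A node of the redex that is neither above nor below \<open>s2\<close> is separated from it at the cut or at
  the tensor, which are unswitched; the expansion between them has only one summand.  So it cannot
  be a root of the same subnet.
\<close>

lemma subnet_roots_in_context:
  assumes "subnet G E" "switching G \<tau>" "[n, 0, 0, 1] \<in> roots G E"
    and "u \<in> roots G E" "u \<noteq> [n, 0, 0, 1]"
  shows "hd u \<noteq> n"
proof
  assume "hd u = n"
  have sub: "substructure G E" using assms(1) by (simp add: subnet_def)
  have u: "u \<in> nodes G" using assms(4) substructureD(1)[OF sub] by (auto simp: roots_def)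
  have "u \<parallel> [n, 0, 0, 1]"
    using root_prefix_not_in[OF sub assms(3), of u] root_prefix_not_in[OF sub assms(4)] assms(3-5)
    by (auto simp: roots_def strict_prefix_def parallel_def)
  then obtain c i a j b where c: "i \<noteq> j" "u = c @ i # a" "[n, 0, 0, 1] = c @ j # b"
    using parallel_decomp by blast
  have "c \<noteq> []" using c \<open>hd u = n\<close> by auto
  have "switched G c"
    by (rule subnet_fork_switched[OF assms(1,2) _ _ c(1) \<open>c \<noteq> []\<close>]) (use c assms(3,4) in simp_all)
  then have "c \<noteq> [n]" "c \<noteq> [n, 0, 0]"
    using redex_nodes by (auto simp: switched_def is_expansion_def)
  with c(3) \<open>c \<noteq> []\<close> have "c = [n, 0]" "j = 0" by (auto simp: Cons_eq_append_conv)
  moreover have "c @ [i] \<in> nodes G"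
    by (rule nodes_prefix[OF _ u]) (simp_all add: c(2))
  ultimately show False
    using c(1) redex_nodes(2) nodes_snoc[of "[n, 0]" i G] by (simp add: child_labels_def)
qed

end

section \<open>Pruning\<close>

lemma prune_sum_map:
  "prune_sum U p k ws = map (\<lambda>i. prune_wit U (p @ [i]) (ws ! (i - k)))
    (filter (\<lambda>i. p @ [i] \<notin> U) [k..<k + length ws])"
proof (induction ws arbitrary: k)
  case (Cons w ws)
  have "[k..<k + length (w # ws)] = k # [Suc k..<Suc k + length ws]"
    by (simp add: upt_conv_Cons del: upt_Suc)
  moreover have "(w # ws) ! (i - k) = ws ! (i - Suc k)" if "Suc k \<le> i" for i
    using that by (simp add: nth_Cons' Suc_diff_Suc)
  ultimately show ?case by (auto simp: Cons.IH simp del: upt_Suc)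
qed simp

lemma prune_map:
  "prune U k F = map (\<lambda>i. prune_root U [i] (F ! (i - k)))
    (filter (\<lambda>i. [i] \<notin> U) [k..<k + length F])"
proof (induction F arbitrary: k)
  case (Cons r F)
  have "[k..<k + length (r # F)] = k # [Suc k..<Suc k + length F]"
    by (simp add: upt_conv_Cons del: upt_Suc)
  moreover have "(r # F) ! (i - k) = F ! (i - Suc k)" if "Suc k \<le> i" for i
    using that by (simp add: nth_Cons' Suc_diff_Suc)
  ultimately show ?case by (auto simp: Cons.IH simp del: upt_Suc)
qed simp

primrec prune_label :: "node set \<Rightarrow> node \<Rightarrow> 'v label \<Rightarrow> 'v label" where
  "prune_label U p (TreeLabel t) = TreeLabel (prune_tree U p t)"
| "prune_label U p (WitLabel w) = WitLabel (prune_wit U p w)"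
| "prune_label U p StarLabel = StarLabel"
| "prune_label U p (CutLabel t s) = CutLabel (prune_tree U (p @ [0]) t) (prune_tree U (p @ [1]) s)"

lemma root_label_prune_root [simp]: "root_label (prune_root U p r) = prune_label U p (root_label r)"
  by (cases r) auto

lemma prune_label_wire [simp]:
  "prune_label U p l = WitLabel (Var v) \<longleftrightarrow> l = WitLabel (Var v)"
  "prune_label U p l = WitLabel (CoVar v) \<longleftrightarrow> l = WitLabel (CoVar v)"
proof -
  have "prune_wit U p w = Var v \<longleftrightarrow> w = Var v" "prune_wit U p w = CoVar v \<longleftrightarrow> w = CoVar v"
    for w :: "'a witness"
    by (cases w; simp)+
  then show "prune_label U p l = WitLabel (Var v) \<longleftrightarrow> l = WitLabel (Var v)"
    "prune_label U p l = WitLabel (CoVar v) \<longleftrightarrow> l = WitLabel (CoVar v)"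
    by (cases l; simp)+
qed

text \<open>
  The origins of the successors of a pruned node, in order.  Deleting roots or summands shifts the
  later ones; at all other nodes the number of successors is kept, and a pruned disjunct is the
  origin of the \<open>*\<close> that replaces it.
\<close>

definition origin_indices :: "('v, 'p) forest \<Rightarrow> node set \<Rightarrow> node \<Rightarrow> nat list" where
  "origin_indices G U q =
    (if q = [] \<or> is_expansion G q then filter (\<lambda>i. q @ [i] \<notin> U) [0..<length (child_labels G q)]
     else [0..<length (child_labels G q)])"

definition prune_origin :: "('v, 'p) forest \<Rightarrow> node set \<Rightarrow> node \<Rightarrow> node" where
  "prune_origin G U p = foldl (\<lambda>q i. q @ [origin_indices G U q ! i]) [] p"

lemma prune_origin_simps [simp]:
  "prune_origin G U [] = []"
  "prune_origin G U (p @ [i]) = prune_origin G U p @ [origin_indices G U (prune_origin G U p) ! i]"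
  by (simp_all add: prune_origin_def)

lemma length_prune_origin [simp]: "length (prune_origin G U p) = length p"
  by (induction p rule: rev_induct) auto

lemma set_origin_indices:
  "k \<in> set (origin_indices G U q) \<Longrightarrow> k < length (child_labels G q)"
  "k < length (child_labels G q) \<Longrightarrow> q @ [k] \<notin> U \<Longrightarrow> k \<in> set (origin_indices G U q)"
  by (auto simp: origin_indices_def split: if_splits)

lemma distinct_origin_indices: "distinct (origin_indices G U q)"
  by (simp add: origin_indices_def)

text \<open>
  The admissible sets of nodes: besides roots, only successors of switched nodes are removed, and
  never all successors of one node.
\<close>

locale pruning =
  fixes G :: "('v, 'p) forest" and U :: "node set"
  assumes prunable: "u \<in> U \<Longrightarrow> u \<in> nodes G \<and>
    ((\<exists>i. u = [i]) \<or> (\<exists>p q. switched G p \<and> successor G p u \<and> successor G p q \<and> q \<notin> U))"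
begin

definition survives :: "node \<Rightarrow> bool" where
  "survives q \<longleftrightarrow> (\<forall>u \<in> U. \<not> prefix u q)"

abbreviation "origin \<equiv> prune_origin G U"
abbreviation "pruned \<equiv> prune U 0 G"

lemma survives_Nil: "survives []"
  using prunable by (force simp: survives_def)

lemma survives_snoc: "survives (q @ [k]) \<longleftrightarrow> survives q \<and> q @ [k] \<notin> U"
  by (auto simp: survives_def)

lemma pruned_child:
  assumes "q @ [k] \<in> U" "q \<noteq> []"
  shows "switched G q \<and> (\<exists>j. j < length (child_labels G q) \<and> q @ [j] \<notin> U)"
  using prunable[OF assms(1)] assms(2) by (auto simp: successor_snoc)

lemma child_labels_prune:
  assumes "p = [] \<and> q = [] \<or>
    (\<exists>l. node_at G q = Some l \<and> node_at pruned p = Some (prune_label U q l))"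
  shows "child_labels pruned p = map (\<lambda>k. if q @ [k] \<in> U then StarLabel
      else prune_label U (q @ [k]) (child_labels G q ! k)) (origin_indices G U q)"
  using assms
proof (elim disjE exE conjE)
  assume "p = []" "q = []"
  then show ?thesis by (auto simp: child_labels_def origin_indices_def prune_map)
next
  fix l assume l: "node_at G q = Some l" "node_at pruned p = Some (prune_label U q l)"
  then have ne: "p \<noteq> []" "q \<noteq> []" by auto
  show ?thesis
  proof (cases "is_expansion G q")
    case True
    then obtain ws where "l = TreeLabel (Expansion ws)" using l by (auto simp: is_expansion_def)
    with True l ne show ?thesis
      by (auto simp: child_labels_def origin_indices_def prune_sum_map)
  next
    case False
    show ?thesis
    proof (cases "\<exists>t s. l = TreeLabel (Disj t s)")
      case True
      then obtain t s where ts: "l = TreeLabel (Disj t s)" by blast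
      have "\<not> (q @ [0] \<in> U \<and> q @ [1] \<in> U)"
        using pruned_child[of q 0] l(1) ne ts by (auto simp: child_labels_def less_Suc_eq)
      with l ne ts False show ?thesis
        by (auto simp: child_labels_def origin_indices_def)
    next
      case Disj: False
      have "q @ [k] \<notin> U" for k
        using pruned_child[of q k] l(1) ne Disj False by (auto simp: switched_def)
      with l ne False Disj show ?thesis
        by (cases l rule: children.cases)
          (auto simp: child_labels_def origin_indices_def is_expansion_def)
    qed
  qed
qed

text \<open>
  Descending from the roots, the first removed origin that is met belongs to a new \<open>*\<close>, which has
  no successors.  Hence all other origins have no removed node above them.
\<close>

lemma node_at_prune:
  "node_at pruned p = Some l' \<Longrightarrow> origin p \<in> nodes G \<and>
    (origin p \<in> U \<and> l' = StarLabel \<or>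
     survives (origin p) \<and> (\<exists>l. node_at G (origin p) = Some l \<and> l' = prune_label U (origin p) l))"
proof (induction p arbitrary: l' rule: rev_induct)
  case (snoc i p)
  let ?q = "origin p"
  from snoc.prems have i: "i < length (child_labels pruned p)" "l' = child_labels pruned p ! i"
    by (auto simp: node_at_snoc split: if_splits)
  have q: "survives ?q \<and> (p = [] \<and> ?q = [] \<or>
    (\<exists>l. node_at G ?q = Some l \<and> node_at pruned p = Some (prune_label U ?q l)))"
  proof (cases "p = []")
    case False
    with i have "\<exists>l0. node_at pruned p = Some l0 \<and> children l0 \<noteq> []"
      by (cases "node_at pruned p") (auto simp: child_labels_def)
    with snoc.IH show ?thesis by fastforce
  qed (simp add: survives_Nil)
  note ch = child_labels_prune[OF conjunct2[OF q]]
  define k where "k = origin_indices G U ?q ! i"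
  have "k < length (child_labels G ?q)"
    using i(1) ch by (auto simp: k_def intro!: set_origin_indices(1)[of _ G U])
  moreover have "l' = (if ?q @ [k] \<in> U then StarLabel
      else prune_label U (?q @ [k]) (child_labels G ?q ! k))"
    using i ch by (simp add: k_def)
  ultimately show ?case
    using q by (auto simp: k_def[symmetric] nodes_snoc node_at_snoc survives_snoc)
qed simp

lemma origin_node: "p \<in> nodes pruned \<Longrightarrow> origin p \<in> nodes G"
  using node_at_prune by (auto simp: nodes_def)

lemma node_at_survivor:
  assumes "p \<in> nodes pruned" "origin p \<notin> U"
  obtains l where "node_at G (origin p) = Some l" "node_at pruned p = Some (prune_label U (origin p) l)"
    "survives (origin p)"
  using assms node_at_prune by (fastforce simp: nodes_def)

lemma child_of_survivor:
  assumes "p @ [i] \<in> nodes pruned"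
  shows "p = [] \<or> p \<in> nodes pruned \<and> origin p \<notin> U"
    and "child_labels pruned p = map (\<lambda>k. if origin p @ [k] \<in> U then StarLabel
      else prune_label U (origin p @ [k]) (child_labels G (origin p) ! k))
      (origin_indices G U (origin p))"
proof -
  show *: "p = [] \<or> p \<in> nodes pruned \<and> origin p \<notin> U"
  proof (cases "p = []")
    case False
    with assms have p: "p \<in> nodes pruned" by (rule nodes_snocD)
    then obtain l where l: "node_at pruned p = Some l" by (auto simp: nodes_def)
    have "l \<noteq> StarLabel"
      using assms False l by (auto simp: nodes_snoc child_labels_def)
    moreover have "survives (origin p) \<Longrightarrow> origin p \<notin> U" by (auto simp: survives_def)
    ultimately show ?thesis using node_at_prune[OF l] p by blast
  qed simp
  show "child_labels pruned p = map (\<lambda>k. if origin p @ [k] \<in> U then StarLabel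
      else prune_label U (origin p @ [k]) (child_labels G (origin p) ! k))
      (origin_indices G U (origin p))"
    using * by (intro child_labels_prune) (auto elim: node_at_survivor)
qed

lemma inj_origin: "inj_on origin (nodes pruned)"
proof (rule inj_onI)
  fix p p' assume "p \<in> nodes pruned" "p' \<in> nodes pruned" "origin p = origin p'"
  then show "p = p'"
  proof (induction p arbitrary: p' rule: rev_induct)
    case (snoc i p)
    have "length (p @ [i]) = length p'"
      using arg_cong[OF snoc.prems(3), of length] by simp
    then obtain r j where p': "p' = r @ [j]" by (metis append_is_Nil_conv length_0_conv rev_exhaust)
    have eq: "origin p = origin r" using snoc.prems(3) by (simp add: p')
    have "p = r"
    proof (cases "p = [] \<or> r = []")
      case True
      then show ?thesis using \<open>length (p @ [i]) = length p'\<close> by (auto simp: p')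
    next
      case False
      then show ?thesis using snoc.IH[OF _ _ eq] snoc.prems nodes_snocD by (metis p')
    qed
    moreover have "i = j"
    proof -
      have "i < length (origin_indices G U (origin p))" "j < length (origin_indices G U (origin p))"
        using child_of_survivor(2)[OF snoc.prems(1)] snoc.prems(1,2) \<open>p = r\<close>
        by (simp_all add: nodes_snoc p')
      with snoc.prems(3) eq show ?thesis
        using nth_eq_iff_index_eq[OF distinct_origin_indices, of i G U "origin p" j]
        by (simp add: p')
    qed
    ultimately show ?case by (simp add: p')
  qed simp
qed

lemma survivor_has_origin:
  "q \<in> nodes G \<Longrightarrow> survives q \<Longrightarrow> \<exists>p \<in> nodes pruned. origin p = q"
proof (induction q rule: rev_induct)
  case (snoc k q)
  have q: "survives q" "q @ [k] \<notin> U" using snoc.prems by (auto simp: survives_snoc)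
  have "\<exists>p. origin p = q \<and> (p = [] \<and> q = [] \<or> p \<in> nodes pruned)"
  proof (cases "q = []")
    case False
    with snoc q show ?thesis using nodes_snocD by blast
  qed (auto intro!: exI[of _ "[]"])
  then obtain p where p: "origin p = q" "p = [] \<and> q = [] \<or> p \<in> nodes pruned" by blast
  have "q \<notin> U" using q(1) by (auto simp: survives_def)
  with p have "child_labels pruned p = map (\<lambda>k. if q @ [k] \<in> U then StarLabel
      else prune_label U (q @ [k]) (child_labels G q ! k)) (origin_indices G U q)"
    by (intro child_labels_prune) (auto elim: node_at_survivor)
  moreover from snoc.prems(1) q(2) obtain i
    where "i < length (origin_indices G U q)" "origin_indices G U q ! i = k"
    using set_origin_indices(2)[of k G q U] by (auto simp: nodes_snoc in_set_conv_nth)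
  ultimately have "p @ [i] \<in> nodes pruned \<and> origin (p @ [i]) = q @ [k]"
    by (simp add: nodes_snoc p(1))
  then show ?case by blast
qed simp

lemma successor_origin: "successor pruned p q \<Longrightarrow> successor G (origin p) (origin q)"
  using origin_node by (auto simp: successor_def)

lemma successor_survives: "successor pruned p q \<Longrightarrow> origin p \<notin> U"
  by (metis Nil_not_node child_of_survivor(1) successor_def)

lemma axiom_link_origin:
  assumes "axiom_link pruned p q"
  shows "axiom_link G (origin p) (origin q)" "origin p \<notin> U" "origin q \<notin> U"
proof -
  have wire: "node_at G (origin p) = Some (WitLabel w) \<and> origin p \<notin> U"
    if "node_at pruned p = Some (WitLabel w)" "w = Var v \<or> w = CoVar v" for p w v
  proof -
    have "survives (origin p)" "node_at G (origin p) = Some (WitLabel w)"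
      using node_at_prune[OF that(1)] that(2) by (metis label.distinct(8) prune_label_wire)+
    then show ?thesis by (auto simp: survives_def)
  qed
  show "axiom_link G (origin p) (origin q)" "origin p \<notin> U" "origin q \<notin> U"
    using assms unfolding axiom_link_def by (blast dest: wire)+
qed

text \<open>
  Pruning turns a switched node into an unswitched one only by replacing one of its two disjuncts
  by \<open>*\<close>, so the remaining successor is unique.
\<close>

lemma unswitched_origin:
  assumes "p \<in> nodes pruned" "\<not> switched pruned p" "switched G (origin p)"
    and "successor G (origin p) q" "q \<notin> U" "successor G (origin p) r" "r \<notin> U"
    and "origin p \<notin> U"
  shows "q = r"
proof -
  obtain l where l: "node_at G (origin p) = Some l"
      "node_at pruned p = Some (prune_label U (origin p) l)"
    using node_at_survivor[OF assms(1,8)] by blast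
  with assms(2,3) obtain t s where ts: "l = TreeLabel (Disj t s)"
    by (auto simp: switched_def is_expansion_def)
  with l assms(2) have "origin p @ [0] \<in> U \<or> origin p @ [1] \<in> U"
    by (auto simp: switched_def split: if_splits)
  with assms(4-7) l(1) ts show ?thesis
    by (auto simp: successor_snoc child_labels_def less_Suc_eq)
qed

text \<open>
  A switching \<open>\<sigma>'\<close> after pruning is extended to one before pruning: a disjunction that has lost
  its choice selects the disjunct that is left.  The switching graph of \<open>\<sigma>'\<close> is then a subgraph of
  the extended one, up to the new occurrences of \<open>*\<close>, which are leaves.
\<close>

lemma AC_prune:
  assumes "switching G \<tau>" "AC G"
  shows "AC pruned"
  unfolding AC_def
proof (intro allI impI)
  fix \<sigma>' assume \<sigma>': "switching pruned \<sigma>'"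
  define \<sigma> where "\<sigma> q = (if q \<in> nodes G \<and> survives q then
      (let p = the_inv_into (nodes pruned) origin q in
       if switched pruned p then origin (\<sigma>' p) else (SOME r. successor G q r \<and> r \<notin> U))
    else \<tau> q)" for q
  have survives: "survives (origin p)" if "p \<in> nodes pruned" "origin p \<notin> U" for p
    using node_at_survivor[OF that] .
  have \<sigma>_origin: "\<sigma> (origin p) = (if switched pruned p then origin (\<sigma>' p)
      else (SOME r. successor G (origin p) r \<and> r \<notin> U))"
    if "p \<in> nodes pruned" "origin p \<notin> U" for p
    using that survives origin_node by (simp add: \<sigma>_def the_inv_into_f_f[OF inj_origin])
  have kept: "successor G q (SOME r. successor G q r \<and> r \<notin> U) \<and>
      (SOME r. successor G q r \<and> r \<notin> U) \<notin> U" if "switched G q" for q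
  proof (rule someI_ex)
    have "successor G q (\<tau> q)" using assms(1) that by (simp add: switching_def)
    then obtain k where k: "\<tau> q = q @ [k]" "q \<noteq> []" "k < length (child_labels G q)"
      by (auto simp: successor_snoc)
    then obtain j where "j < length (child_labels G q)" "q @ [j] \<notin> U"
      using pruned_child[of q k] by (cases "q @ [k] \<in> U") auto
    with k(2) show "\<exists>r. successor G q r \<and> r \<notin> U" by (auto simp: successor_snoc)
  qed
  have "switching G \<sigma>"
    unfolding switching_def
  proof (intro allI impI)
    fix q assume q: "switched G q"
    show "successor G q (\<sigma> q)"
    proof (cases "q \<in> nodes G \<and> survives q")
      case True
      then obtain p where p: "p \<in> nodes pruned" "origin p = q" using survivor_has_origin by blast
      have "q \<notin> U" using True by (auto simp: survives_def)
      have "switched pruned p \<Longrightarrow> successor G q (origin (\<sigma>' p))"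
        using \<sigma>' successor_origin p(2) by (auto simp: switching_def)
      then show ?thesis
        using kept[OF q] \<sigma>_origin[OF p(1)] \<open>q \<notin> U\<close> p(2) by auto
    next
      case False
      then show ?thesis using assms(1) q by (auto simp: switching_def \<sigma>_def)
    qed
  qed
  define E where "E = switching_graph G \<sigma>"
  define E' where "E' = switching_graph pruned \<sigma>'"
  have "acyclic_graph E"
    using \<open>switching G \<sigma>\<close> assms(2) by (simp add: AC_def E_def)
  have nodes: "x \<in> nodes pruned \<and> y \<in> nodes pruned" if "{x, y} \<in> E'" for x y
    using that unfolding E'_def by (rule switching_graph_in_nodes)
  have mapped: "{origin x, origin y} \<in> E" if "{x, y} \<in> E'" "origin x \<notin> U" "origin y \<notin> U" for x y
    using that(1) unfolding E'_def
  proof (cases rule: switching_graph_cases)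
    case (1 p q)
    have pq: "p \<in> nodes pruned" "origin p \<notin> U" "origin q \<notin> U"
      using 1(1,2) that(2,3) by (auto simp: successor_def doubleton_eq_iff)
    have succ: "successor G (origin p) (origin q)" using 1(2) by (rule successor_origin)
    have "\<sigma> (origin p) = origin q" if "switched G (origin p)"
    proof (cases "switched pruned p")
      case True
      then show ?thesis using \<sigma>_origin[OF pq(1,2)] 1(3) by simp
    next
      case False
      then show ?thesis
        using unswitched_origin[OF pq(1) False that _ _ succ pq(3,2)] kept[OF that]
          \<sigma>_origin[OF pq(1,2)] by simp
    qed
    with succ have "{origin q, origin p} \<in> E" unfolding E_def switching_graph_def by blast
    with 1(1) show ?thesis by (auto simp: doubleton_eq_iff insert_commute)
  next
    case (2 p q)
    then have "{origin p, origin q} \<in> E"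
      using axiom_link_origin(1) unfolding E_def switching_graph_def by blast
    with 2(1) show ?thesis by (auto simp: doubleton_eq_iff insert_commute)
  qed
  have leaf: "y = butlast x \<and> origin y \<notin> U" if "{x, y} \<in> E'" "origin x \<in> U" for x y
    using that(1) unfolding E'_def
  proof (cases rule: switching_graph_cases)
    case (1 p q)
    then have "x = q" "y = p" "origin p \<notin> U"
      using successor_survives[OF 1(2)] that(2) by (auto simp: doubleton_eq_iff)
    then show ?thesis using 1(2) by (auto simp: successor_def)
  next
    case (2 p q)
    then show ?thesis
      using axiom_link_origin(2,3)[OF 2(2)] that(2) by (auto simp: doubleton_eq_iff)
  qed
  \<comment> \<open>The edge from a new \<open>*\<close> to its disjunction is contracted, since the edge from the
    replaced disjunct is not in the switching graph.\<close>
  define g where "g x = (if origin x \<in> U then origin (butlast x) else origin x)" for x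
  show "acyclic_graph (switching_graph pruned \<sigma>')"
    unfolding E'_def[symmetric]
  proof (rule acyclic_graph_pullback[OF \<open>acyclic_graph E\<close>, where g = g])
    fix x y assume xy: "{x, y} \<in> E'" "x \<noteq> y"
    then have yx: "{y, x} \<in> E'" by (simp add: insert_commute)
    note inj = inj_on_eq_iff[OF inj_origin]
    let ?e = "{origin x, origin y}"
    consider "origin x \<in> U" | "origin y \<in> U" | "origin x \<notin> U" "origin y \<notin> U" by blast
    then show "(\<forall>z. {x, z} \<in> E' \<longrightarrow> z = y) \<or> (\<forall>z. {y, z} \<in> E' \<longrightarrow> z = x) \<or>
      (\<exists>c d. {c, d} \<in> E \<and> c \<noteq> d \<and>
        connected_in (E - {{c, d}}) c (g x) \<and> connected_in (E - {{c, d}}) (g y) d \<and>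
        (\<forall>x' y'. {x', y'} \<in> E' \<and> {x', y'} \<noteq> {x, y} \<longrightarrow>
          connected_in (E - {{c, d}}) (g x') (g y')))"
    proof cases
      case 1
      then show ?thesis using leaf[OF xy(1)] leaf by metis
    next
      case 2
      then show ?thesis using leaf[OF yx] leaf by metis
    next
      case 3
      have "connected_in (E - {?e}) (g x') (g y')"
        if x'y': "{x', y'} \<in> E'" "{x', y'} \<noteq> {x, y}" for x' y'
      proof -
        have y'x': "{y', x'} \<in> E'" using x'y'(1) by (simp add: insert_commute)
        consider "origin x' \<in> U" | "origin y' \<in> U" | "origin x' \<notin> U" "origin y' \<notin> U" by blast
        then show ?thesis
        proof cases
          case 1
          then show ?thesis using leaf[OF x'y'(1)] by (auto simp: g_def)
        next
          case 2
          then show ?thesis using leaf[OF y'x'] by (auto simp: g_def)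
        next
          case 3
          have "{origin x', origin y'} \<noteq> ?e"
            using x'y'(2) nodes[OF xy(1)] nodes[OF x'y'(1)] by (auto simp: doubleton_eq_iff inj)
          with mapped[OF x'y'(1) 3] 3 show ?thesis by (auto simp: g_def)
        qed
      qed
      moreover have "origin x \<noteq> origin y" using xy(2) nodes[OF xy(1)] by (simp add: inj)
      ultimately show ?thesis
        using mapped[OF xy(1) 3] 3
        by (intro disjI2 exI[of _ "origin x"] exI[of _ "origin y"]) (auto simp: g_def)
    qed
  qed
qed

lemma prune_sum_typing:
  assumes p: "node_at G p = Some (TreeLabel (Expansion ws))" and "ws \<noteq> []"
    and typed: "\<And>w q. w \<in> set ws \<Longrightarrow> node_at G q = Some (WitLabel w) \<Longrightarrow>
      wit_typing \<Gamma> (prune_wit U q w) W"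
  shows "prune_sum U p 0 ws \<noteq> []" "\<And>w. w \<in> set (prune_sum U p 0 ws) \<Longrightarrow> wit_typing \<Gamma> w W"
proof -
  have "p \<noteq> []" using p by auto
  with p have "length (child_labels G p) = length ws" by (simp add: child_labels_def)
  then obtain j where "j < length ws" "p @ [j] \<notin> U"
    using pruned_child[of p 0] \<open>p \<noteq> []\<close> \<open>ws \<noteq> []\<close> by (cases "p @ [0] \<in> U") auto
  then show "prune_sum U p 0 ws \<noteq> []" by (auto simp: prune_sum_map filter_empty_conv)
  fix w assume "w \<in> set (prune_sum U p 0 ws)"
  then obtain k where "k < length ws" "w = prune_wit U (p @ [k]) (ws ! k)"
    by (auto simp: prune_sum_map)
  moreover from this have "node_at G (p @ [k]) = Some (WitLabel (ws ! k))"
    using node_at_child[OF p] by simp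
  ultimately show "wit_typing \<Gamma> w W" using typed by simp
qed

lemma prune_typing:
  "tree_typing \<Gamma> t A \<Longrightarrow> node_at G p = Some (TreeLabel t) \<Longrightarrow> tree_typing \<Gamma> (prune_tree U p t) A"
  "wit_typing \<Gamma> w W \<Longrightarrow> node_at G p = Some (WitLabel w) \<Longrightarrow> wit_typing \<Gamma> (prune_wit U p w) W"
proof (induction arbitrary: p and p rule: tree_typing_wit_typing.inducts)
  case (3 t A s B)
  then show ?case using node_at_child[OF 3(5), of 0] node_at_child[OF 3(5), of 1]
    by (auto intro: tree_typing_wit_typing.intros)
next
  case (5 t A B)
  then show ?case using node_at_child[OF 5(3), of 0] by (auto intro: tree_typing_wit_typing.intros)
next
  case (6 t B A)
  then show ?case using node_at_child[OF 6(3), of 1] by (auto intro: tree_typing_wit_typing.intros)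
next
  case (7 t A s B)
  then show ?case using node_at_child[OF 7(5), of 0] node_at_child[OF 7(5), of 1]
    by (auto intro: tree_typing_wit_typing.intros)
next
  case (8 ws a)
  show ?case
    using prune_sum_typing[OF 8(4) 8(1) 8(3)] by (auto intro: tree_typing_wit_typing.intros)
next
  case (9 ws a)
  show ?case
    using prune_sum_typing[OF 9(4) 9(1) 9(3)] by (auto intro: tree_typing_wit_typing.intros)
next
  case (10 ws A B)
  show ?case
    using prune_sum_typing[OF 10(4) 10(1) 10(3)] by (auto intro: tree_typing_wit_typing.intros)
qed (auto intro: tree_typing_wit_typing.intros)

lemma prune_root_typing:
  assumes "\<forall>r \<in> set G. root_typing \<Gamma> r"
  shows "\<forall>r \<in> set pruned. root_typing \<Gamma> r"
proof
  fix r' assume "r' \<in> set pruned"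
  then obtain i where i: "i < length G" "r' = prune_root U [i] (G ! i)"
    by (auto simp: prune_map)
  have node: "node_at G [i] = Some (root_label (G ! i))" using i by (simp add: node_at_def)
  have "root_typing \<Gamma> (G ! i)" using assms i(1) by simp
  with node show "root_typing \<Gamma> r'"
    using node_at_child[OF node, of 0] node_at_child[OF node, of 1]
    by (cases "G ! i") (auto simp: i(2) intro: prune_typing)
qed

end

lemma prune_unaffected:
  fixes t :: "'v tree" and w :: "'v witness" and ws :: "'v witness list"
  shows "(\<forall>q. p @ q \<notin> U) \<Longrightarrow> prune_tree U p t = t"
    and "(\<forall>q. p @ q \<notin> U) \<Longrightarrow> prune_wit U p w = w"
    and "(\<forall>q. p @ q \<notin> U) \<Longrightarrow> prune_sum U p k ws = ws"
  by (induction U p t and U p w and U p k ws rule: prune_tree_prune_wit_prune_sum.induct) auto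

section \<open>Types of the reduct\<close>

text \<open>
  The new cut formula is neither \<open>Top\<close> nor \<open>Bot\<close>, because no tree has type \<open>Bot\<close>.
\<close>

lemma redex_typing:
  assumes "root_typing \<Gamma> (Cut (Expansion [Tensor s1 s2]) (WeakR t) (And A B))"
  shows "root_typing \<Gamma> (Cut s1 t A)"
proof -
  have exp: "tree_typing \<Gamma> (Expansion [Tensor s1 s2]) (And A B)"
    and weak: "tree_typing \<Gamma> (WeakR t) (Or (dual A) (dual B))"
    using assms by auto
  from exp have "wit_typing \<Gamma> (Tensor s1 s2) (TensorWit A B)" by cases auto
  then have "tree_typing \<Gamma> s1 A" by cases
  moreover from weak have "tree_typing \<Gamma> t (dual A)" by cases
  moreover have "\<not> tree_typing \<Gamma> r Bot" for r
    by (auto elim: tree_typing.cases)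
  ultimately show ?thesis by auto
qed

lemma forest_type_prune: "forest_type (prune U k F) \<subseteq># forest_type F"
proof (induction F arbitrary: k)
  case (Cons r F)
  have "root_type (prune_root U [k] r) = root_type r" by (cases r) auto
  with Cons[of "Suc k"] show ?case
    by (auto simp: forest_type_def map_filter_simps split: option.splits
        intro: subset_mset.order_trans)
qed (simp add: forest_type_def)

lemma forest_type_append: "forest_type (F @ F') = forest_type F + forest_type F'"
  by (simp add: forest_type_def List.map_filter_def)

lemma prune_append:
  "prune U k (F @ F') = prune U k F @ prune U (k + length F) F'"
  by (induction F arbitrary: k) auto

section \<open>The reduct of a cut against a weakening\<close>

theorem proposition59:
  fixes \<Gamma> :: "'v \<Rightarrow> 'p"
    and F G F' G' :: "('v, 'p) forest"
    and s1 s2 t :: "'v tree"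
    and A B :: "'p formula"
    and E U :: "node set"
    and n2 :: node
  assumes "G = F @ [Cut (Expansion [Tensor s1 s2]) (WeakR t) (And A B)]"
    and "typed_forest \<Gamma> G"
    and "AC G"
    and "n2 = [length F, 0, 0, 1]"
    and "subnet G E"
    and "n2 \<in> roots G E"
    and "U = roots G E - {n2}"
    and "\<forall>u \<in> U. removable G E u"
    and "F' = prune U 0 F"
    and "G' = F' @ [Cut s1 t A]"
  shows "typed_forest \<Gamma> G' \<and> AC G' \<and> forest_type G' \<subseteq># forest_type G"
proof -
  define n where "n = length F"
  define R where "R = F @ [Cut s1 t A]"
  interpret cut_reduction F s1 s2 t A "And A B" n G R
    by unfold_locales (simp_all add: assms(1) n_def R_def)
  have n2: "n2 = [n, 0, 0, 1]" using assms(4) by (simp add: n_def)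
  have sub: "substructure G E" using assms(5) by (simp add: subnet_def)
  have typed: "\<forall>r \<in> set G. root_typing \<Gamma> r" using assms(2) by (simp add: typed_forest_def)
  then obtain \<tau> where \<tau>: "switching G \<tau>" using switching_exists by blast
  have typed_R: "\<forall>r \<in> set R. root_typing \<Gamma> r"
    using typed redex_typing[of \<Gamma> s1 s2 t A B] by (simp add: assms(1) R_def)
  have U: "u \<in> roots G E" "u \<in> E" "u \<in> nodes G" "hd u \<noteq> n" "u \<noteq> []" if "u \<in> U" for u
    using that subnet_roots_in_context[OF assms(5) \<tau>, of u] assms(6) substructureD(1)[OF sub]
    by (auto simp: assms(7) n2 roots_def)
  have same: "successor R p q" if "successor G p q" "hd q \<noteq> n" for p q
  proof -
    from that(1) obtain i where "q = p @ [i]" "p \<in> nodes G" "q \<in> nodes G"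
      unfolding successor_def by blast
    moreover from \<open>p \<in> nodes G\<close> have "p \<noteq> []" by auto
    ultimately show ?thesis
      using that(2) node_at_unchanged[of p] node_at_unchanged[of q] by (simp add: successor_def nodes_def)
  qed
  interpret pr: pruning R U
  proof
    fix u assume "u \<in> U"
    note u = U[OF this]
    have "u \<in> nodes R" using u node_at_unchanged[of u] by (simp add: nodes_def)
    have disj: "\<exists>p q. switched R p \<and> successor R p u \<and> successor R p q \<and> q \<notin> U"
      if "switched G p" "successor G p u" "successor G p q" "q \<notin> E" for p q
    proof -
      have "p \<noteq> []" "hd p = hd u" "hd q = hd u"
        using that(1-3) switched_ne_Nil[OF that(1)] by (auto simp: successor_def)
      then have "switched R p"
        using that(1) u(4) node_at_unchanged[of p] by (simp add: switched_def is_expansion_def)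
      moreover have "q \<notin> U" using that(4) U(2) by blast
      moreover have "successor R p u" "successor R p q"
        using same[OF that(2)] same[OF that(3)] \<open>hd q = hd u\<close> u(4) by simp_all
      ultimately show ?thesis by blast
    qed
    have "removable G E u" using assms(8) \<open>u \<in> U\<close> by blast
    then consider "\<not> (\<exists>p. successor G p u)"
      | p q where "is_expansion G p" "successor G p u" "successor G p q" "q \<notin> E"
      | p q where "is_disjunction G p" "successor G p u" "successor G p q" "q \<noteq> u"
          "node_at G q \<noteq> Some StarLabel" "q \<notin> E"
      unfolding removable_def by blast
    then show "u \<in> nodes R \<and> ((\<exists>i. u = [i]) \<or>
        (\<exists>p q. switched R p \<and> successor R p u \<and> successor R p q \<and> q \<notin> U))"
    proof cases
      case 1
      obtain p i where "u = p @ [i]" using u(5) by (metis rev_exhaust)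
      with 1 u(3) have "p = []" using nodes_snocD by (auto simp: successor_def)
      with \<open>u = p @ [i]\<close> \<open>u \<in> nodes R\<close> show ?thesis by simp
    next
      case 2
      then show ?thesis using disj \<open>u \<in> nodes R\<close> by (auto simp: switched_def)
    next
      case 3
      \<comment> \<open>The disjunction is not a default weakening: its \<open>*\<close> cannot be \<open>q\<close>, and it cannot be a
        root of \<open>E\<close> because a substructure contains the predecessor of each of its \<open>*\<close>.\<close>
      have "node_at G u \<noteq> Some StarLabel"
      proof
        assume "node_at G u = Some StarLabel"
        with 3(2) u(2) have "p \<in> E" using substructureD(4)[OF sub] by blast
        with 3(2) u(1) show False by (auto simp: roots_def)
      qed
      with 3 have "switched G p"
        by (auto simp: is_disjunction_def switched_def successor_snoc child_labels_def node_at_snoc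
            less_Suc_eq split: if_splits)
      with 3 show ?thesis using disj \<open>u \<in> nodes R\<close> by blast
    qed
  qed
  have G': "G' = prune U 0 R"
  proof -
    have "n # q \<notin> U" for q using U(4)[of "n # q"] by auto
    then show ?thesis
      by (simp add: assms(9,10) R_def prune_append prune_unaffected flip: n_def)
  qed

  \<comment> \<open>The nodes that disappear are those of \<open>E\<close>, apart from a few that carry no wire variable.
    As \<open>E\<close> is closed under axiom links, wire variables are lost in dual pairs.\<close>
  have outside: "cut_origin n q \<notin> E" if "pr.survives q" for q
  proof
    assume "cut_origin n q \<in> E"
    then obtain u where u: "u \<in> roots G E" "prefix u (cut_origin n q)"
      using substructure_root_above[OF sub] by blast
    then have "u \<in> U" using cut_origin_not_in_discarded by (auto simp: assms(7) n2)
    then have "hd (cut_origin n q) \<noteq> n" using u(2) U(4,5)[of u] by (auto simp: prefix_def)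
    then have "cut_origin n q = q" by (simp add: hd_cut_origin cut_origin_other)
    with u(2) \<open>u \<in> U\<close> that show False by (simp add: pr.survives_def)
  qed
  have wire_down: "node_at G (cut_origin n (pr.origin p)) = Some (WitLabel w) \<and>
      cut_origin n (pr.origin p) \<notin> E \<and> p \<in> nodes G' \<and> pr.origin p \<in> nodes R"
    if "node_at G' p = Some (WitLabel w)" "w = Var v \<or> w = CoVar v" for p w v
  proof -
    have "pr.survives (pr.origin p)" "node_at R (pr.origin p) = Some (WitLabel w)"
      using pr.node_at_prune[OF that(1)[unfolded G']] that(2)
      by (metis label.distinct(8) prune_label_wire)+
    moreover from this(2) have "pr.origin p \<noteq> [n]" using redex_nodes(6) by auto
    ultimately show ?thesis
      using outside that(1) node_at_cut_origin[of "pr.origin p"] by (auto simp: nodes_def)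
  qed
  have wire_up: "\<exists>p. node_at G' p = Some (WitLabel w)"
    if "node_at G r = Some (WitLabel w)" "r \<notin> E" "w = Var v \<or> w = CoVar v" for r w v
  proof -
    have r: "r \<in> nodes G" using that(1) by (simp add: nodes_def)
    have "node_at G [n, 1, 1] = Some StarLabel"
      using node_at_child[OF redex_nodes(4), of 1] by simp
    then have "r \<notin> {[n], [n, 0], [n, 1], [n, 1, 1]}" using that(1) redex_nodes by auto
    moreover have "\<not> prefix [n, 0, 0, 1] r"
      using substructure_prefix[OF sub _ _ r] assms(6) that(2) by (auto simp: n2 roots_def)
    ultimately obtain q where q: "q \<in> nodes R" "cut_origin n q = r"
      using cut_origin_surj[OF r] by blast
    have "q \<noteq> [n]" using q(2) that(1,3) redex_nodes(3) by auto
    then have label: "node_at R q = Some (WitLabel w)" using node_at_cut_origin[OF q(1)] q(2) that(1) by simp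
    have "pr.survives q"
      unfolding pr.survives_def
    proof (intro ballI notI)
      fix u assume u: "u \<in> U" "prefix u q"
      then have "hd q \<noteq> n" using U(4,5)[OF u(1)] by (auto simp: prefix_def)
      then have "q = r" using q(2) cut_origin_other by metis
      then show False using substructure_prefix[OF sub U(2)[OF u(1)] _ r] u(2) that(2) by blast
    qed
    then obtain p where p: "p \<in> nodes G'" "pr.origin p = q"
      using pr.survivor_has_origin[OF q(1)] G' by blast
    have "q \<notin> U" using \<open>pr.survives q\<close> by (auto simp: pr.survives_def)
    with p label have "node_at G' p = Some (prune_label U q (WitLabel w))"
      by (auto simp: G' elim: pr.node_at_survivor)
    with that(3) show ?thesis by auto
  qed
  have wire_inj: "p = q"
    if "p \<in> nodes G'" "q \<in> nodes G'" "cut_origin n (pr.origin p) = cut_origin n (pr.origin q)"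
    for p q
    using that inj_on_eq_iff[OF inj_cut_origin] inj_on_eq_iff[OF pr.inj_origin] pr.origin_node
    by (auto simp: G')
  have wire_unique: "p = q"
    if "node_at G' p = Some (WitLabel w)" "node_at G' q = Some (WitLabel w)"
      "w = Var v \<or> w = CoVar v" for p q w v
  proof (rule wire_inj)
    have "a = b" if "node_at G a = Some (WitLabel w)" "node_at G b = Some (WitLabel w)" for a b
      using assms(2) that \<open>w = Var v \<or> w = CoVar v\<close> unfolding typed_forest_def by blast
    then show "cut_origin n (pr.origin p) = cut_origin n (pr.origin q)"
      using wire_down[OF that(1,3)] wire_down[OF that(2,3)] by blast
  qed (use wire_down[OF that(1,3)] wire_down[OF that(2,3)] in simp_all)

  have "typed_forest \<Gamma> G'"
    unfolding typed_forest_def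
  proof (intro conjI allI impI iffI)
    show "\<forall>r \<in> set G'. root_typing \<Gamma> r"
      using pr.prune_root_typing[OF typed_R] by (simp add: G')
  next
    fix v p q
    assume "node_at G' p = Some (WitLabel (Var v)) \<and> node_at G' q = Some (WitLabel (Var v))"
    then show "p = q"
      using wire_unique by blast
  next
    fix v p q
    assume "node_at G' p = Some (WitLabel (CoVar v)) \<and> node_at G' q = Some (WitLabel (CoVar v))"
    then show "p = q"
      using wire_unique by blast
  next
    fix v assume "\<exists>p. node_at G' p = Some (WitLabel (Var v))"
    then obtain q where q: "node_at G q = Some (WitLabel (Var v))" "q \<notin> E" using wire_down by blast
    then obtain r where r: "node_at G r = Some (WitLabel (CoVar v))"
      using assms(2) unfolding typed_forest_def by blast
    with q have "r \<notin> E" using substructureD(3)[OF sub, of r q] by (auto simp: axiom_link_def)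
    with r show "\<exists>p. node_at G' p = Some (WitLabel (CoVar v))" using wire_up by blast
  next
    fix v assume "\<exists>p. node_at G' p = Some (WitLabel (CoVar v))"
    then obtain q where q: "node_at G q = Some (WitLabel (CoVar v))" "q \<notin> E" using wire_down by blast
    then obtain r where r: "node_at G r = Some (WitLabel (Var v))"
      using assms(2) unfolding typed_forest_def by blast
    with q have "r \<notin> E" using substructureD(3)[OF sub, of r q] by (auto simp: axiom_link_def)
    with r show "\<exists>p. node_at G' p = Some (WitLabel (Var v))" using wire_up by blast
  qed
  moreover have "AC G'"
  proof -
    obtain \<tau>' where "switching R \<tau>'" using switching_exists[OF typed_R] by blast
    with AC_reduct[OF \<tau> assms(3)] show ?thesis using pr.AC_prune by (simp add: G')
  qed
  moreover have "forest_type G' \<subseteq># forest_type G"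
    using forest_type_prune[of U 0 F]
    by (simp add: assms(1,9,10) forest_type_append)
      (simp add: forest_type_def List.map_filter_def)
  ultimately show ?thesis by blast
qed

end
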